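(* Any link (with non-null determinant) can be represented by a lune-free diagram.
   Context: A lune of a link diagram is a two-sided region (bigon) of the underlying 4-regular plane graph. A link diagram is lune-free if it has no two-sided regions. *)

theory Defs
  imports "HOL-Analysis.Analysis" "Jordan_Normal_Form.Determinant"
begin

text \<open>
  Three-space is \<open>\<real>\<^sup>2 \<times> \<real>\<close>: link diagrams arise from the projection \<^const>\<open>fst\<close> to the plane,
  and \<^const>\<open>snd\<close> is the height that decides which strand of a crossing is the upper one.
\<close>

type_synonym plane = "real^2"
type_synonym space = "plane \<times> real"


section \<open>Links\<close>

definition disjoint_closed_curves :: "space set \<Rightarrow> bool" where
  "disjoint_closed_curves L \<longleftrightarrow>
     (\<exists>\<K>. finite \<K> \<and> \<K> \<noteq> {} \<and> pairwise disjnt \<K> \<and> L = \<Union>\<K> \<and>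
        (\<forall>K\<in>\<K>. \<exists>g. simple_path g \<and> pathfinish g = pathstart g \<and> K = path_image g))"

definition polygonal_link :: "space set \<Rightarrow> bool" where
  "polygonal_link L \<longleftrightarrow>
     disjoint_closed_curves L \<and>
     (\<exists>S. finite S \<and> L = (\<Union>(a, b)\<in>S. closed_segment a b))"

definition ambient_isotopic :: "space set \<Rightarrow> space set \<Rightarrow> bool" where
  "ambient_isotopic K L \<longleftrightarrow>
     (\<exists>H :: real \<Rightarrow> space \<Rightarrow> space.
        continuous_on ({0..1} \<times> UNIV) (\<lambda>(t, x). H t x) \<and>
        (\<forall>t\<in>{0..1}. \<exists>G. homeomorphism UNIV UNIV (H t) G) \<and>
        (\<forall>x. H 0 x = x) \<and>
        H 1 ` K = L)"

text \<open>Links are tame: wild ones have no diagrams with finitely many crossings.\<close>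

definition link :: "space set \<Rightarrow> bool" where
  "link L \<longleftrightarrow> disjoint_closed_curves L \<and> (\<exists>P. polygonal_link P \<and> ambient_isotopic L P)"


section \<open>Link diagrams\<close>

text \<open>
  A diagram is given by a polygonal link in regular position: the picture is its projection, with
  the strands at a double point distinguished by their heights.
\<close>

definition crossings :: "space set \<Rightarrow> plane set" where
  "crossings P = {x. \<exists>p\<in>P. \<exists>q\<in>P. p \<noteq> q \<and> fst p = x \<and> fst q = x}"

definition straight_at :: "space set \<Rightarrow> space \<Rightarrow> space \<Rightarrow> bool" where
  "straight_at P p u \<longleftrightarrow> (\<exists>e>0. P \<inter> ball p e = range (\<lambda>t. p + t *\<^sub>R u) \<inter> ball p e)"

text \<open>
  Every crossing is a transverse double point, and none of its two preimages is a bend of the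
  polygon.
\<close>

definition link_diagram :: "space set \<Rightarrow> bool" where
  "link_diagram P \<longleftrightarrow>
     polygonal_link P \<and>
     finite (crossings P) \<and>
     (\<forall>x. finite {p \<in> P. fst p = x} \<and> card {p \<in> P. fst p = x} \<le> 2) \<and>
     (\<forall>p\<in>P. \<forall>q\<in>P. p \<noteq> q \<and> fst p = fst q \<longrightarrow>
        (\<exists>u v. straight_at P p u \<and> straight_at P q v \<and> \<not> collinear {0, fst u, fst v}))"

definition represents :: "space set \<Rightarrow> space set \<Rightarrow> bool" where
  "represents P L \<longleftrightarrow> link_diagram P \<and> ambient_isotopic L P"


section \<open>Lunes\<close>

text \<open>
  The underlying 4-regular plane graph has the crossings as vertices. A component of the link
  whose projection meets no crossing yields one closed edge without vertices.
\<close>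

definition edges :: "space set \<Rightarrow> plane set set" where
  "edges P = components (fst ` P - crossings P)"

text \<open>The unbounded region is included.\<close>

definition regions :: "space set \<Rightarrow> plane set set" where
  "regions P = components (- (fst ` P))"

text \<open>
  Since all vertices have even degree, no edge is a bridge, so every edge has different regions on
  its two sides, and counting the edges in the frontier of a region counts its sides with the
  correct multiplicity.
\<close>

definition sides :: "space set \<Rightarrow> plane set \<Rightarrow> plane set set" where
  "sides P R = {e \<in> edges P. e \<subseteq> frontier R}"

definition lune :: "space set \<Rightarrow> plane set \<Rightarrow> bool" where
  "lune P R \<longleftrightarrow> R \<in> regions P \<and> card (sides P R) = 2"

definition lune_free :: "space set \<Rightarrow> bool" where
  "lune_free P \<longleftrightarrow> (\<nexists>R. lune P R)"


section \<open>The determinant\<close>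

definition undercrossings :: "space set \<Rightarrow> space set" where
  "undercrossings P = {p \<in> P. \<exists>q\<in>P. fst q = fst p \<and> snd p < snd q}"

text \<open>An arc runs from one undercrossing to the next, or is a whole component without any.\<close>

definition arcs :: "space set \<Rightarrow> space set set" where
  "arcs P = components (P - undercrossings P)"

definition over_arc_at :: "space set \<Rightarrow> plane \<Rightarrow> space set \<Rightarrow> bool" where
  "over_arc_at P x a \<longleftrightarrow> a \<in> arcs P \<and> (\<exists>q\<in>a. fst q = x)"

definition under_arcs_at :: "space set \<Rightarrow> plane \<Rightarrow> space set set" where
  "under_arcs_at P x = {a \<in> arcs P. \<exists>p\<in>undercrossings P. fst p = x \<and> p \<in> closure a}"

text \<open>
  Each crossing contributes the Fox colouring equation \<open>2 c(over) - c(under\<^sub>1) - c(under\<^sub>2) = 0\<close>,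
  and \<open>colouring_coeff P x a\<close> is the coefficient of the colour of the arc \<open>a\<close> in it. If the set
  of under-arcs is a singleton, the same arc arrives at the crossing from both sides. The over-arc
  may also coincide with an under-arc.
\<close>

definition colouring_coeff :: "space set \<Rightarrow> plane \<Rightarrow> space set \<Rightarrow> int" where
  "colouring_coeff P x a =
     (if over_arc_at P x a then 2 else 0) -
     (if under_arcs_at P x = {a} then 2 else if a \<in> under_arcs_at P x then 1 else 0)"

definition colouring_matrix :: "space set \<Rightarrow> plane list \<Rightarrow> space set list \<Rightarrow> int mat" where
  "colouring_matrix P xs as =
     mat (length xs) (length as) (\<lambda>(i, j). colouring_coeff P (xs ! i) (as ! j))"

text \<open>
  The determinant is the absolute value of any minor obtained from the colouring matrix by deleting
  one row and one column. This presupposes as many arcs as crossings, i.e. that every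
  component has an undercrossing; type I Reidemeister moves provide such a diagram of any link.
\<close>

definition diagram_has_determinant :: "space set \<Rightarrow> int \<Rightarrow> bool" where
  "diagram_has_determinant P d \<longleftrightarrow>
     (\<exists>xs as i j. distinct xs \<and> set xs = crossings P \<and> distinct as \<and> set as = arcs P \<and>
        length xs = length as \<and> i < length xs \<and> j < length as \<and>
        d = \<bar>Determinant.det (mat_delete (colouring_matrix P xs as) i j)\<bar>)"

text \<open>
  The determinant of a link is read off from any such diagram. It does not depend on the
  diagram and the minor; the definition is a relation so as not to presuppose this.
\<close>

definition has_determinant :: "space set \<Rightarrow> int \<Rightarrow> bool" where
  "has_determinant L d \<longleftrightarrow> (\<exists>P. represents P L \<and> diagram_has_determinant P d)"

end

theory Submission
  imports Defs
begin

text \<open>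
  A kink, that is a type I Reidemeister move, does not change the link, and the new region inside the
  kink is a monogon, which is not a lune. A kink cuts the edge on which it is placed into two outer
  parts and the loop, and the regions on both sides of the edge see the outer parts. Sufficiently many
  kinks on all edges therefore leave only monogons and regions with at least three sides. Since the
  determinant of a link is computed from one of its diagrams, there is a diagram to start from.

  For the proof it is convenient to put four kinks in a row wherever kinks are needed. The three edges
  between their crossings have an explicit form, are different from each other, and are sides of the
  region on either side of the row (\<open>four_kinks_no_lune\<close>). So a region that reaches a row is a monogon
  or has at least three sides, without any knowledge about the rest of the diagram. To make all regions reach a
  row, the rows are placed at finitely many points that represent all straight pieces of the diagram
  (\<open>polygon_generic_points\<close>). The frontier of a region is infinite and thus contains points of a
  straight piece; from there it follows that piece until it comes to a row
  (\<open>link_diagram_lune_free\<close>).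

  A kink is realized by an explicit ambient isotopy composed of three shears (\<open>kink_isotopy\<close>), in
  coordinates adapted to the strand. Its support is a vertical prism that contains nothing of the link
  except for a straight piece, so that kinks can be inserted one by one (\<open>insert_kink\<close>,
  \<open>insert_kinks\<close>).
\<close>

section \<open>Ambient isotopies\<close>

text \<open>
  An ambient isotopy is used only through the map at its end. Recording that map turns the
  operations on isotopies into composition and conjugation of maps.
\<close>

definition isotopic_to_id :: "('a::topological_space \<Rightarrow> 'a) \<Rightarrow> bool" where
  "isotopic_to_id h \<longleftrightarrow>
     (\<exists>H :: real \<Rightarrow> 'a \<Rightarrow> 'a.
        continuous_on ({0..1} \<times> UNIV) (\<lambda>(t, x). H t x) \<and>
        (\<forall>t\<in>{0..1}. \<exists>G. homeomorphism UNIV UNIV (H t) G) \<and>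
        (\<forall>x. H 0 x = x) \<and> H 1 = h)"

lemma ambient_isotopic_iff:
  "ambient_isotopic K L \<longleftrightarrow> (\<exists>h. isotopic_to_id h \<and> h ` K = L)"
  unfolding ambient_isotopic_def isotopic_to_id_def by blast

lemma isotopic_to_id_homeomorphism:
  assumes "isotopic_to_id h"
  obtains g where "homeomorphism UNIV UNIV h g"
  using assms unfolding isotopic_to_id_def by force

text \<open>
  Both motions run at the same time instead of one after the other, so that nothing has to be glued
  in the time direction.
\<close>

lemma isotopic_to_id_comp:
  assumes "isotopic_to_id h" "isotopic_to_id k"
  shows "isotopic_to_id (k \<circ> h)"
proof -
  obtain H where H: "continuous_on ({0..1} \<times> UNIV) (\<lambda>(t, x). H t x)"
     "\<forall>t\<in>{0..1}. \<exists>G. homeomorphism UNIV UNIV (H t) G" "\<forall>x. H (0::real) x = x" "H 1 = h"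
    using assms(1) unfolding isotopic_to_id_def by blast
  obtain K where K: "continuous_on ({0..1} \<times> UNIV) (\<lambda>(t, x). K t x)"
     "\<forall>t\<in>{0..1}. \<exists>G. homeomorphism UNIV UNIV (K t) G" "\<forall>x. K (0::real) x = x" "K 1 = k"
    using assms(2) unfolding isotopic_to_id_def by blast
  have c1: "continuous_on ({0..1} \<times> UNIV) (\<lambda>p. H (fst p) (snd p))"
    using H(1) by (simp add: case_prod_unfold)
  have c2: "continuous_on ({0..1} \<times> UNIV) (\<lambda>p. K (fst p) (snd p))"
    using K(1) by (simp add: case_prod_unfold)
  have "continuous_on ({0..1} \<times> UNIV) (\<lambda>p. K (fst p) (H (fst p) (snd p)))"
    using continuous_on_compose2[OF c2 continuous_on_Pair[OF continuous_on_fst[OF continuous_on_id] c1]]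
    by (simp add: image_subset_iff)
  moreover have "\<exists>G. homeomorphism UNIV UNIV (K t \<circ> H t) G" if "t \<in> {0..1}" for t
    using that H(2) K(2) homeomorphism_compose by blast
  ultimately show ?thesis
    unfolding isotopic_to_id_def using H K
    by (intro exI[of _ "\<lambda>t. K t \<circ> H t"]) (auto simp: case_prod_unfold o_def)
qed

lemma ambient_isotopic_refl: "ambient_isotopic K K"
proof -
  have "isotopic_to_id (\<lambda>x::space. x)"
    unfolding isotopic_to_id_def
    by (intro exI[of _ "\<lambda>t x. x"]) (auto simp: case_prod_unfold intro!: continuous_intros exI[of _ "\<lambda>x. x"] homeomorphismI)
  then show ?thesis unfolding ambient_isotopic_iff by (intro exI[of _ "\<lambda>x. x"]) simp
qed

lemma ambient_isotopic_trans:
  assumes "ambient_isotopic K L" "ambient_isotopic L M" shows "ambient_isotopic K M"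
proof -
  obtain h k where "isotopic_to_id h" "h ` K = L" "isotopic_to_id k" "k ` L = M"
    using assms unfolding ambient_isotopic_iff by blast
  then have "isotopic_to_id (k \<circ> h)" "(k \<circ> h) ` K = M"
    using isotopic_to_id_comp by (auto simp: image_comp)
  then show ?thesis unfolding ambient_isotopic_iff by blast
qed

lemma isotopic_to_id_conjugate:
  assumes h: "isotopic_to_id h" and f: "homeomorphism UNIV UNIV f f'"
  shows "isotopic_to_id (f \<circ> h \<circ> f')"
proof -
  obtain H where H: "continuous_on ({0..1} \<times> UNIV) (\<lambda>(t, x). H t x)"
     "\<forall>t\<in>{0..1}. \<exists>G. homeomorphism UNIV UNIV (H t) G" "\<forall>x. H (0::real) x = x" "H 1 = h"
    using h unfolding isotopic_to_id_def by blast
  have f': "homeomorphism UNIV UNIV f' f" using f homeomorphism_symD by blast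
  have cf: "continuous_on UNIV f" "continuous_on UNIV f'" and ff: "\<And>x. f (f' x) = x"
    using f by (auto simp: homeomorphism_def)
  have c1: "continuous_on ({0..1} \<times> UNIV) (\<lambda>p. H (fst p) (snd p))"
    using H(1) by (simp add: case_prod_unfold)
  have c2: "continuous_on ({0..1} \<times> UNIV) (\<lambda>p::real \<times> 'b. (fst p, f' (snd p)))"
    by (intro continuous_intros continuous_on_compose2[OF cf(2)]) auto
  have "continuous_on ({0..1} \<times> UNIV) (\<lambda>p. f (H (fst p) (f' (snd p))))"
    using continuous_on_compose2[OF cf(1) continuous_on_compose2[OF c1 c2]]
    by (auto simp: image_subset_iff)
  moreover have "\<exists>G. homeomorphism UNIV UNIV (f \<circ> H t \<circ> f') G" if t: "t \<in> {0..1}" for t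
  proof -
    obtain G where "homeomorphism UNIV UNIV (H t) G" using bspec[OF H(2) t] by blast
    then have "homeomorphism UNIV UNIV (H t \<circ> f') (f \<circ> G)"
      by (rule homeomorphism_compose[OF f'])
    then have "homeomorphism UNIV UNIV (f \<circ> (H t \<circ> f')) (f \<circ> G \<circ> f')"
      by (rule homeomorphism_compose[OF _ f])
    then show ?thesis by (auto simp: o_assoc)
  qed
  ultimately show ?thesis
    unfolding isotopic_to_id_def using H ff
    by (intro exI[of _ "\<lambda>t. f \<circ> H t \<circ> f'"]) (auto simp: case_prod_unfold o_def)
qed

text \<open>
  The map moves every line parallel to \<open>v\<close> within itself. On such a line the displacement is a
  contraction, which makes every stage injective and, by the fixed point theorem of Banach,
  surjective; invariance of domain makes the inverse continuous.
\<close>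

lemma isotopic_to_id_shear:
  fixes v :: "'a::euclidean_space" and \<phi> :: "'a \<Rightarrow> real"
  assumes cont: "continuous_on UNIV \<phi>" and v: "v \<noteq> 0" and c: "0 \<le> c" "c < 1"
    and lip: "\<And>p s. \<bar>\<phi> (p + s *\<^sub>R v) - \<phi> p\<bar> \<le> c * \<bar>s\<bar>"
  shows "isotopic_to_id (\<lambda>p. p + \<phi> p *\<^sub>R v)"
proof -
  define H where "H = (\<lambda>(t::real) p. p + (t * \<phi> p) *\<^sub>R v)"
  have cH: "continuous_on UNIV (H t)" for t
    unfolding H_def by (intro continuous_intros cont)
  \<comment> \<open>Points with the same image lie on one line, where the contraction bounds their distance by a fraction of itself.\<close>
  have inj: "inj (H t)" if t: "t \<in> {0..1}" for t
  proof
    fix p q assume "H t p = H t q"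
    then have e: "p = q + (t * (\<phi> q - \<phi> p)) *\<^sub>R v"
      unfolding H_def by (auto simp: algebra_simps)
    define s where "s = t * (\<phi> q - \<phi> p)"
    have p: "p = q + s *\<^sub>R v" using e s_def by simp
    have "\<bar>\<phi> q - \<phi> p\<bar> \<le> c * \<bar>s\<bar>" using lip[of q s] p by (simp add: abs_minus_commute)
    then have "\<bar>s\<bar> \<le> 1 * (c * \<bar>s\<bar>)"
      unfolding s_def abs_mult using t by (intro mult_mono) (auto simp: s_def abs_mult)
    then have "(1 - c) * \<bar>s\<bar> \<le> 0" by (simp add: algebra_simps)
    then have "s = 0" using c by (auto simp: mult_le_0_iff)
    then show "p = q" using p by simp
  qed
  have surj: "surj (H t)" if t: "t \<in> {0..1}" for t
  proof -
    have "\<exists>p. H t p = q" for q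
    proof -
      \<comment> \<open>The point of the line through \<open>q\<close> that is moved to \<open>q\<close> is a fixed point of a contraction.\<close>
      have "\<exists>!s\<in>UNIV. - t * \<phi> (q + s *\<^sub>R v) = s"
      proof (rule Banach_fix[of UNIV c])
        show "complete (UNIV::real set)" by (rule complete_UNIV)
        fix x y :: real
        have "\<bar>\<phi> (q + x *\<^sub>R v) - \<phi> (q + y *\<^sub>R v)\<bar> \<le> c * \<bar>x - y\<bar>"
          using lip[of "q + y *\<^sub>R v" "x - y"] by (simp add: algebra_simps)
        then have "\<bar>t\<bar> * \<bar>\<phi> (q + x *\<^sub>R v) - \<phi> (q + y *\<^sub>R v)\<bar> \<le> 1 * (c * \<bar>x - y\<bar>)"
          using t by (intro mult_mono) auto
        then show "dist (- t * \<phi> (q + x *\<^sub>R v)) (- t * \<phi> (q + y *\<^sub>R v)) \<le> c * dist x y"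
          by (simp add: dist_real_def abs_mult[symmetric] algebra_simps abs_minus_commute)
      qed (use c in auto)
      then obtain s where s: "- t * \<phi> (q + s *\<^sub>R v) = s" by blast
      have "H t (q + s *\<^sub>R v) = q + (s + t * \<phi> (q + s *\<^sub>R v)) *\<^sub>R v"
        unfolding H_def by (simp add: algebra_simps)
      also have "s + t * \<phi> (q + s *\<^sub>R v) = 0" using s by simp
      finally show ?thesis by auto
    qed
    then show ?thesis by (metis surjI)
  qed
  have "\<exists>G. homeomorphism UNIV UNIV (H t) G" if "t \<in> {0..1}" for t
    using invariance_of_domain_homeomorphism[OF open_UNIV cH[of t] order_refl inj[OF that]]
      surj[OF that] by metis
  moreover have "continuous_on ({0..1} \<times> UNIV) (\<lambda>(t, p). H t p)"
    unfolding H_def case_prod_unfold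
    by (intro continuous_intros continuous_on_compose2[OF cont]) auto
  ultimately show ?thesis
    unfolding isotopic_to_id_def by (intro exI[of _ H]) (auto simp: H_def)
qed

section \<open>Frames along a strand\<close>

text \<open>
  A frame puts the origin at \<open>c\<close> and lets the first axis run along \<open>u\<close>, which may be inclined. The
  third axis stays vertical, so that the projection to the plane forgets the third coordinate
  (\<open>fst_frame\<close>); the second axis is horizontal and orthogonal to the projection of \<open>u\<close>. In these
  coordinates every straight piece of a diagram looks alike.
\<close>

definition rot :: "plane \<Rightarrow> plane" where
  "rot a = vector [- vec_nth a 2, vec_nth a 1]"

lemma inner_rot [simp]: "rot a \<bullet> a = 0" "a \<bullet> rot a = 0" "rot a \<bullet> rot a = a \<bullet> a"
  by (simp_all add: rot_def inner_vec_def sum_2)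

lemma norm_rot [simp]: "norm (rot a) = norm a"
  by (simp add: norm_eq_sqrt_inner)

lemma rot_scaleR: "rot (s *\<^sub>R a) = s *\<^sub>R rot a"
  by (simp add: rot_def Finite_Cartesian_Product.vec_eq_iff forall_2)

definition plane_frame :: "plane \<Rightarrow> plane \<Rightarrow> real \<times> real \<Rightarrow> plane" where
  "plane_frame c a w = c + fst w *\<^sub>R a + snd w *\<^sub>R rot a"

definition plane_coord :: "plane \<Rightarrow> plane \<Rightarrow> plane \<Rightarrow> real \<times> real" where
  "plane_coord c a q = ((q - c) \<bullet> a / (a \<bullet> a), (q - c) \<bullet> rot a / (a \<bullet> a))"

definition frame :: "space \<Rightarrow> space \<Rightarrow> (real \<times> real) \<times> real \<Rightarrow> space" where
  "frame c u w = (plane_frame (fst c) (fst u) (fst w), snd c + fst (fst w) * snd u + snd w)"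

definition coord :: "space \<Rightarrow> space \<Rightarrow> space \<Rightarrow> (real \<times> real) \<times> real" where
  "coord c u q = (plane_coord (fst c) (fst u) (fst q),
     snd q - snd c - fst (plane_coord (fst c) (fst u) (fst q)) * snd u)"

lemma plane_coord_plane_frame [simp]: "a \<noteq> 0 \<Longrightarrow> plane_coord c a (plane_frame c a w) = w"
  by (simp add: plane_coord_def plane_frame_def inner_add_left prod_eq_iff)

lemma plane_frame_plane_coord [simp]:
  assumes "a \<noteq> 0" shows "plane_frame c a (plane_coord c a q) = q"
proof -
  have a: "vec_nth a 1 * vec_nth a 1 + vec_nth a 2 * vec_nth a 2 \<noteq> 0"
    using assms by (simp add: Finite_Cartesian_Product.vec_eq_iff forall_2 sum_squares_eq_zero_iff)
  show ?thesis
    using a unfolding plane_frame_def plane_coord_def rot_def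
    by (simp add: Finite_Cartesian_Product.vec_eq_iff forall_2 inner_vec_def sum_2 divide_simps) (auto simp: algebra_simps)
qed

lemma fst_frame [simp]: "fst (frame c u w) = plane_frame (fst c) (fst u) (fst w)"
  by (simp add: frame_def)

lemma fst_coord [simp]: "fst (coord c u q) = plane_coord (fst c) (fst u) (fst q)"
  by (simp add: coord_def)

lemma coord_frame [simp]: "fst u \<noteq> 0 \<Longrightarrow> coord c u (frame c u w) = w"
  by (simp add: coord_def frame_def)

lemma frame_coord [simp]: "fst u \<noteq> 0 \<Longrightarrow> frame c u (coord c u q) = q"
  by (simp add: coord_def frame_def)

lemma continuous_on_plane_frame: "continuous_on S (plane_frame c a)"
  unfolding plane_frame_def by (intro continuous_intros)

lemma continuous_on_plane_coord: "continuous_on S (plane_coord c a)"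
  unfolding plane_coord_def divide_inverse by (intro continuous_intros)

lemma continuous_on_frame: "continuous_on S (frame c u)"
  unfolding frame_def plane_frame_def by (intro continuous_intros)

lemma continuous_on_coord: "continuous_on S (coord c u)"
  unfolding coord_def plane_coord_def divide_inverse by (simp, intro continuous_intros)

lemma homeomorphism_frame:
  "fst u \<noteq> 0 \<Longrightarrow> homeomorphism UNIV UNIV (frame c u) (coord c u)"
  by (rule homeomorphismI) (auto simp: continuous_on_frame continuous_on_coord)

lemma plane_frame_shift: "plane_frame (c + s *\<^sub>R a) a (x, y) = plane_frame c a (x + s, y)"
  by (simp add: plane_frame_def algebra_simps)

lemma frame_eq_iff [simp]: "fst u \<noteq> 0 \<Longrightarrow> frame c u v = frame c u w \<longleftrightarrow> v = w"
  by (metis coord_frame)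

lemma plane_frame_eq_iff [simp]: "a \<noteq> 0 \<Longrightarrow> plane_frame c a v = plane_frame c a w \<longleftrightarrow> v = w"
  by (metis plane_coord_plane_frame)

lemma frame_image_iff:
  assumes "fst u \<noteq> 0" shows "q \<in> frame c u ` S \<longleftrightarrow> coord c u q \<in> S"
  using assms by (metis coord_frame frame_coord image_iff)

lemma plane_frame_image_iff:
  assumes "a \<noteq> 0" shows "q \<in> plane_frame c a ` S \<longleftrightarrow> plane_coord c a q \<in> S"
  using assms by (metis plane_coord_plane_frame plane_frame_plane_coord image_iff)

definition square :: "real \<Rightarrow> (real \<times> real) set" where
  "square r = {w. \<bar>fst w\<bar> < r \<and> \<bar>snd w\<bar> < r}"

definition prism :: "space \<Rightarrow> space \<Rightarrow> real \<Rightarrow> space set" where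
  "prism c u r = {q. fst (coord c u q) \<in> square r}"

section \<open>The kink\<close>

definition strand :: "((real \<times> real) \<times> real) set" where
  "strand = {((x, y), z). y = 0 \<and> z = 0}"

text \<open>
  The kink is the polygonal line that comes along the first axis, turns off at \<open>((-2, 0), 0)\<close> to
  \<open>((1, 1), 2)\<close> and \<open>((-1, 1), -2)\<close> and comes back to the axis at \<open>((2, 0), 0)\<close>. Its projection crosses
  itself once, at \<open>(0, 2/3)\<close>, between points of heights \<open>4/3\<close> and \<open>-4/3\<close>.
\<close>

definition kink :: "((real \<times> real) \<times> real) set" where
  "kink = {((x, y), z).
     y = 0 \<and> z = 0 \<and> 2 \<le> \<bar>x\<bar> \<or>
     3 * y = x + 2 \<and> z = 2 * y \<and> -2 \<le> x \<and> x \<le> 1 \<or>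
     y = 1 \<and> z = 2 * x \<and> \<bar>x\<bar> \<le> 1 \<or>
     3 * y = 2 - x \<and> z = - 2 * y \<and> -1 \<le> x \<and> x \<le> 2}"

text \<open>
  The kink is obtained from the axis by lifting the point with parameter \<open>s\<close> to the height
  \<open>kink_height s\<close>, pushing it sideways by \<open>kink_bulge s\<close> and finally pushing it along the axis by its
  height. The last step is what folds the curve over itself: it carries the lifted part forward and
  the lowered part back.
\<close>

definition kink_height :: "real \<Rightarrow> real" where
  "kink_height s = \<bar>s + 2\<bar> - \<bar>s - 2\<bar> - 2 * \<bar>s + 1\<bar> + 2 * \<bar>s - 1\<bar>"

definition kink_bulge :: "real \<Rightarrow> real" where
  "kink_bulge s = (\<bar>s + 2\<bar> - \<bar>s + 1\<bar> - \<bar>s - 1\<bar> + \<bar>s - 2\<bar>) / 2"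

lemma kink_pieces:
  "2 \<le> \<bar>s\<bar> \<Longrightarrow> kink_height s = 0 \<and> kink_bulge s = 0"
  "-2 \<le> s \<Longrightarrow> s \<le> -1 \<Longrightarrow> kink_height s = 2 * s + 4 \<and> kink_bulge s = s + 2"
  "-1 \<le> s \<Longrightarrow> s \<le> 1 \<Longrightarrow> kink_height s = - 2 * s \<and> kink_bulge s = 1"
  "1 \<le> s \<Longrightarrow> s \<le> 2 \<Longrightarrow> kink_height s = 2 * s - 4 \<and> kink_bulge s = 2 - s"
  by (auto simp: kink_height_def kink_bulge_def abs_if split: if_splits)

lemma kink_parametrization:
  "(\<lambda>s. ((s + kink_height s, kink_bulge s), kink_height s)) ` UNIV = kink" (is "range ?E = _")
proof
  have "?E s \<in> kink" for s
  proof -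
    consider "2 \<le> \<bar>s\<bar>" | "-2 \<le> s" "s \<le> -1" | "-1 \<le> s" "s \<le> 1" | "1 \<le> s" "s \<le> 2"
      by linarith
    then show ?thesis
      by cases (use kink_pieces[of s] in \<open>auto simp: kink_def\<close>)
  qed
  then show "range ?E \<subseteq> kink" by blast
  show "kink \<subseteq> range ?E"
  proof
    fix w assume "w \<in> kink"
    then obtain x y z where w: "w = ((x, y), z)" and
      "y = 0 \<and> z = 0 \<and> 2 \<le> \<bar>x\<bar> \<or>
       3 * y = x + 2 \<and> z = 2 * y \<and> -2 \<le> x \<and> x \<le> 1 \<or>
       y = 1 \<and> z = 2 * x \<and> \<bar>x\<bar> \<le> 1 \<or>
       3 * y = 2 - x \<and> z = - 2 * y \<and> -1 \<le> x \<and> x \<le> 2"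
      by (auto simp: kink_def)
    then have "w = ?E (x - z)"
      using kink_pieces[of "x - z"] by (elim disjE) (auto simp: w)
    then show "w \<in> range ?E" by blast
  qed
qed

lemma clamp_lipschitz:
  fixes a b :: real
  shows "\<bar>max 0 a - max 0 b\<bar> \<le> \<bar>a - b\<bar>" "\<bar>min 1 a - min 1 b\<bar> \<le> \<bar>a - b\<bar>"
  by linarith+

lemma kink_height_bounds: "\<bar>kink_height s\<bar> \<le> 2" and kink_bulge_bounds: "0 \<le> kink_bulge s" "kink_bulge s \<le> 1"
  by (auto simp: kink_height_def kink_bulge_def abs_if split: if_splits)

text \<open>
  Each of the three pushes is a shear, cut off away from the axis. The cut-offs must vanish outside
  \<open>square 5\<close>, equal 1 on the points that are to be moved, and be flat enough for
  \<open>isotopic_to_id_shear\<close>: the last push has length up to 2, and its cut-off descends with slope \<open>1/3\<close>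
  between the distances 2 and 5. Nothing is cut off in the vertical direction, where a strand
  without crossings has no neighbours.
\<close>

lemma kink_isotopy:
  obtains k where "isotopic_to_id k" "k ` strand = kink"
    "\<And>w. fst w \<notin> square 5 \<Longrightarrow> k w = w"
proof -
  define \<phi>1 where "\<phi>1 = (\<lambda>w::(real \<times> real) \<times> real. kink_height (fst (fst w)) * max 0 (1 - \<bar>snd (fst w)\<bar>))"
  define \<phi>2 where "\<phi>2 = (\<lambda>w::(real \<times> real) \<times> real. kink_bulge (fst (fst w)) * max 0 (1 - \<bar>snd (fst w)\<bar> / 2))"
  define \<phi>3 where "\<phi>3 = (\<lambda>w::(real \<times> real) \<times> real. max (-2) (min 2 (snd w)) *
      max 0 (min 1 (2 - \<bar>snd (fst w)\<bar>)) * max 0 (min 1 (5 / 3 - \<bar>fst (fst w)\<bar> / 3)))"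
  define k1 where "k1 = (\<lambda>w. w + \<phi>1 w *\<^sub>R ((0, 0), 1))"
  define k2 where "k2 = (\<lambda>w. w + \<phi>2 w *\<^sub>R ((0, 1), 0))"
  define k3 where "k3 = (\<lambda>w. w + \<phi>3 w *\<^sub>R ((1, 0), 0))"
  have "isotopic_to_id k1"
    unfolding k1_def
  proof (rule isotopic_to_id_shear[where c = 0])
    show "continuous_on UNIV \<phi>1"
      unfolding \<phi>1_def kink_height_def by (intro continuous_intros)
  qed (auto simp: \<phi>1_def prod_eq_iff)
  moreover have "isotopic_to_id k2"
    unfolding k2_def
  proof (rule isotopic_to_id_shear[where c = "1/2"])
    show "continuous_on UNIV \<phi>2"
      unfolding \<phi>2_def kink_bulge_def by (intro continuous_intros) auto
    fix p :: "(real \<times> real) \<times> real" and s :: real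
    obtain x y z where p: "p = ((x, y), z)" by (metis surj_pair)
    have "\<bar>\<phi>2 (p + s *\<^sub>R ((0, 1), 0)) - \<phi>2 p\<bar> =
       kink_bulge x * \<bar>max 0 (1 - \<bar>y + s\<bar> / 2) - max 0 (1 - \<bar>y\<bar> / 2)\<bar>"
      using kink_bulge_bounds(1)[of x] unfolding \<phi>2_def p
      by (simp add: right_diff_distrib[symmetric] abs_mult)
    also have "\<dots> \<le> 1 * (1 / 2 * \<bar>s\<bar>)"
    proof (intro mult_mono)
      show "\<bar>max 0 (1 - \<bar>y + s\<bar> / 2) - max 0 (1 - \<bar>y\<bar> / 2)\<bar> \<le> 1 / 2 * \<bar>s\<bar>"
        by (rule order_trans[OF clamp_lipschitz(1)]) (simp add: abs_if)
    qed (use kink_bulge_bounds[of x] in auto)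
    finally show "\<bar>\<phi>2 (p + s *\<^sub>R ((0, 1), 0)) - \<phi>2 p\<bar> \<le> 1 / 2 * \<bar>s\<bar>" by simp
  qed (auto simp: prod_eq_iff)
  moreover have "isotopic_to_id k3"
    unfolding k3_def
  proof (rule isotopic_to_id_shear[where c = "2/3"])
    show "continuous_on UNIV \<phi>3"
      unfolding \<phi>3_def by (intro continuous_intros) auto
    fix p :: "(real \<times> real) \<times> real" and s :: real
    obtain x y z where p: "p = ((x, y), z)" by (metis surj_pair)
    define m where "m = max (-2) (min 2 z) * max 0 (min 1 (2 - \<bar>y\<bar>))"
    have "\<bar>m\<bar> \<le> 2 * 1" unfolding m_def abs_mult by (intro mult_mono) auto
    have "\<bar>\<phi>3 (p + s *\<^sub>R ((1, 0), 0)) - \<phi>3 p\<bar> =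
       \<bar>m\<bar> * \<bar>max 0 (min 1 (5 / 3 - \<bar>x + s\<bar> / 3)) - max 0 (min 1 (5 / 3 - \<bar>x\<bar> / 3))\<bar>"
      unfolding \<phi>3_def p m_def abs_mult[symmetric] by (simp add: algebra_simps)
    also have "\<dots> \<le> 2 * (1 / 3 * \<bar>s\<bar>)"
    proof (intro mult_mono)
      show "\<bar>max 0 (min 1 (5 / 3 - \<bar>x + s\<bar> / 3)) - max 0 (min 1 (5 / 3 - \<bar>x\<bar> / 3))\<bar> \<le> 1 / 3 * \<bar>s\<bar>"
        by (rule order_trans[OF clamp_lipschitz(1)], rule order_trans[OF clamp_lipschitz(2)]) (simp add: abs_if)
    qed (use \<open>\<bar>m\<bar> \<le> 2 * 1\<close> in auto)
    finally show "\<bar>\<phi>3 (p + s *\<^sub>R ((1, 0), 0)) - \<phi>3 p\<bar> \<le> 2 / 3 * \<bar>s\<bar>" by simp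
  qed (auto simp: prod_eq_iff)
  ultimately have "isotopic_to_id (k3 \<circ> (k2 \<circ> k1))"
    by (intro isotopic_to_id_comp)
  moreover have E: "(k3 \<circ> (k2 \<circ> k1)) ((s, 0), 0) = ((s + kink_height s, kink_bulge s), kink_height s)" for s
  proof -
    have "max 0 (min 1 (5 / 3 - \<bar>s\<bar> / 3)) = 1 \<or> kink_height s = 0"
      using kink_pieces(1)[of s] by (cases "2 \<le> \<bar>s\<bar>") auto
    moreover have "max (-2) (min 2 (kink_height s)) = kink_height s"
      using kink_height_bounds[of s] by linarith
    ultimately show ?thesis
      using kink_bulge_bounds[of s] by (auto simp: k1_def k2_def k3_def \<phi>1_def \<phi>2_def \<phi>3_def)
  qed
  have strand: "strand = range (\<lambda>s. ((s, 0), 0))" by (auto simp: strand_def)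
  have "(k3 \<circ> (k2 \<circ> k1)) ` strand = range (\<lambda>s. (k3 \<circ> (k2 \<circ> k1)) ((s, 0), 0))"
    unfolding strand image_image ..
  then have "(k3 \<circ> (k2 \<circ> k1)) ` strand = kink"
    unfolding E kink_parametrization .
  moreover have "(k3 \<circ> (k2 \<circ> k1)) w = w" if "fst w \<notin> square 5" for w
  proof -
    obtain x y z where w: "w = ((x, y), z)" by (metis surj_pair)
    have xy: "5 \<le> \<bar>x\<bar> \<or> 5 \<le> \<bar>y\<bar>" using that unfolding w square_def by auto
    then have "\<phi>1 w = 0" "\<phi>2 w = 0" "\<phi>3 w = 0"
      using kink_pieces(1)[of x] by (auto simp: \<phi>1_def \<phi>2_def \<phi>3_def w)
    then show ?thesis by (simp add: k1_def k2_def k3_def zero_prod_def[symmetric])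
  qed
  ultimately show ?thesis using that by blast
qed

section \<open>Polygons and homeomorphisms\<close>

text \<open>
  This is the polygonality part of \<open>polygonal_link\<close>, which unlike the whole notion can be checked
  piece by piece.
\<close>

definition segment_union :: "'a::real_vector set \<Rightarrow> bool" where
  "segment_union X \<longleftrightarrow> (\<exists>S. finite S \<and> X = (\<Union>(a, b)\<in>S. closed_segment a b))"

lemma segment_union_empty: "segment_union {}"
  unfolding segment_union_def by (intro exI[of _ "{}"]) auto

lemma segment_union_segment: "segment_union (closed_segment a b)"
  unfolding segment_union_def by (intro exI[of _ "{(a, b)}"]) auto

lemma segment_union_Un:
  assumes "segment_union X" "segment_union Y" shows "segment_union (X \<union> Y)"
proof -
  obtain S T where "finite S" "X = (\<Union>(a, b)\<in>S. closed_segment a b)"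
    "finite T" "Y = (\<Union>(a, b)\<in>T. closed_segment a b)"
    using assms unfolding segment_union_def by blast
  then show ?thesis unfolding segment_union_def by (intro exI[of _ "S \<union> T"]) auto
qed

lemma segment_union_UN:
  "finite I \<Longrightarrow> (\<And>i. i \<in> I \<Longrightarrow> segment_union (X i)) \<Longrightarrow> segment_union (\<Union>i\<in>I. X i)"
  by (induction I rule: finite_induct) (auto simp: segment_union_empty segment_union_Un)

text \<open>
  A compact convex part of a segment is a segment.
\<close>

lemma segment_union_Int_halfspace:
  fixes X :: "'a::euclidean_space set"
  assumes "segment_union X" shows "segment_union (X \<inter> {q. v \<bullet> q \<ge> r})"
proof -
  obtain S where S: "finite S" "X = (\<Union>(a, b)\<in>S. closed_segment a b)"
    using assms unfolding segment_union_def by blast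
  have seg: "segment_union (closed_segment a b \<inter> {q. v \<bullet> q \<ge> r})" (is "segment_union ?Y") for a b
  proof (cases "?Y = {}")
    case True
    then show ?thesis using segment_union_empty by metis
  next
    case False
    have "compact ?Y" by (intro compact_Int_closed compact_segment closed_halfspace_ge)
    moreover have "convex ?Y" by (intro convex_Int convex_closed_segment convex_halfspace_ge)
    moreover have "collinear ?Y"
      using collinear_closed_segment collinear_subset by (metis inf_le1)
    ultimately obtain a' b' where "?Y = closed_segment a' b'"
      using compact_convex_collinear_segment[OF False] by metis
    then show ?thesis using segment_union_segment by metis
  qed
  have eq: "X \<inter> {q. v \<bullet> q \<ge> r} = (\<Union>p\<in>S. closed_segment (fst p) (snd p) \<inter> {q. v \<bullet> q \<ge> r})"
    using S(2) by auto
  show ?thesis unfolding eq by (intro segment_union_UN S(1) seg)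
qed

lemma frame_affine:
  "frame c u ((1 - t) *\<^sub>R v + t *\<^sub>R w) = (1 - t) *\<^sub>R frame c u v + t *\<^sub>R frame c u w"
  by (simp add: frame_def plane_frame_def prod_eq_iff algebra_simps)

lemma frame_closed_segment:
  "frame c u ` closed_segment v w = closed_segment (frame c u v) (frame c u w)"
proof -
  have "frame c u ` (\<lambda>t. (1 - t) *\<^sub>R v + t *\<^sub>R w) ` {0..1} =
    (\<lambda>t. (1 - t) *\<^sub>R frame c u v + t *\<^sub>R frame c u w) ` {0..1}"
    by (simp only: image_image frame_affine)
  then show ?thesis by (simp only: closed_segment_image_interval)
qed

lemma segment_union_frame:
  assumes "segment_union X" shows "segment_union (frame c u ` X)"
proof -
  obtain S where S: "finite S" "X = (\<Union>(a, b)\<in>S. closed_segment a b)"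
    using assms unfolding segment_union_def by blast
  have eq: "frame c u ` X = (\<Union>p\<in>S. closed_segment (frame c u (fst p)) (frame c u (snd p)))"
    unfolding S(2) by (auto simp: frame_closed_segment[symmetric] image_UN split_beta)
  show ?thesis unfolding eq by (intro segment_union_UN S(1) segment_union_segment)
qed

text \<open>
  A prism is an intersection of four open half-spaces, so cutting it out leaves the intersections
  with their four complements.
\<close>

lemma segment_union_Diff_prism:
  assumes "segment_union X" shows "segment_union (X - prism c u r)"
proof -
  define a where "a = fst u"
  define v where "v = (inverse (a \<bullet> a) *\<^sub>R a, 0::real)"
  define w where "w = (inverse (a \<bullet> a) *\<^sub>R rot a, 0::real)"
  have inner: "(inverse r *\<^sub>R b, 0::real) \<bullet> q - (inverse r *\<^sub>R b, 0) \<bullet> c = (fst q - fst c) \<bullet> b / r"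
    for b :: plane and q :: space and r :: real
    by (simp only: inner_diff_right[symmetric] inner_prod_def fst_conv snd_conv fst_diff
        inner_zero_left add_0_right inner_scaleR_left inner_commute[of b] divide_inverse mult.commute)
      (simp add: inner_diff_left right_diff_distrib)
  have v: "fst (plane_coord (fst c) a (fst q)) = v \<bullet> q - v \<bullet> c" for q
    unfolding v_def inner by (simp only: plane_coord_def fst_conv)
  have w: "snd (plane_coord (fst c) a (fst q)) = w \<bullet> q - w \<bullet> c" for q
    unfolding w_def inner by (simp only: plane_coord_def snd_conv)
  have "q \<in> prism c u r \<longleftrightarrow> \<not> (v \<bullet> q \<ge> v \<bullet> c + r \<or> (- v) \<bullet> q \<ge> r - v \<bullet> c \<or>
      w \<bullet> q \<ge> w \<bullet> c + r \<or> (- w) \<bullet> q \<ge> r - w \<bullet> c)" for q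
    by (simp only: prism_def square_def fst_coord a_def[symmetric] v w mem_Collect_eq inner_minus_left) linarith
  then have "X - prism c u r =
     (X \<inter> {q. v \<bullet> q \<ge> v \<bullet> c + r} \<union> X \<inter> {q. (- v) \<bullet> q \<ge> r - v \<bullet> c}) \<union>
     (X \<inter> {q. w \<bullet> q \<ge> w \<bullet> c + r} \<union> X \<inter> {q. (- w) \<bullet> q \<ge> r - w \<bullet> c})"
    by blast
  then show ?thesis
    using assms by (simp only: segment_union_Un segment_union_Int_halfspace)
qed

lemma disjoint_closed_curves_homeomorphism:
  assumes L: "disjoint_closed_curves L" and h: "homeomorphism UNIV UNIV h g"
  shows "disjoint_closed_curves (h ` L)"
proof -
  have inj: "inj h" using h by (metis UNIV_I homeomorphism_apply1 injI)
  have cont: "continuous_on S h" for S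
    using h continuous_on_subset by (auto simp: homeomorphism_def)
  obtain \<K> where K: "finite \<K>" "\<K> \<noteq> {}" "pairwise disjnt \<K>" "L = \<Union>\<K>"
    "\<forall>K\<in>\<K>. \<exists>g. simple_path g \<and> pathfinish g = pathstart g \<and> K = path_image g"
    using L unfolding disjoint_closed_curves_def by blast
  have "\<exists>g. simple_path g \<and> pathfinish g = pathstart g \<and> h ` K = path_image g" if K': "K \<in> \<K>" for K
  proof -
    obtain p where p: "simple_path p" "pathfinish p = pathstart p" "K = path_image p"
      using bspec[OF K(5) K'] by blast
    have "simple_path (h \<circ> p)"
      by (rule simple_path_continuous_image) (use p cont inj in \<open>auto simp: inj_on_def inj_def\<close>)
    moreover have "pathfinish (h \<circ> p) = pathstart (h \<circ> p)"
      using p by (simp add: pathfinish_compose pathstart_compose)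
    moreover have "h ` K = path_image (h \<circ> p)" using p by (simp add: path_image_compose)
    ultimately show ?thesis by blast
  qed
  moreover have "pairwise disjnt ((`) h ` \<K>)"
    using K(3) by (simp add: pairwise_def disjnt_def image_Int[OF inj, symmetric]) metis
  ultimately show ?thesis
    unfolding disjoint_closed_curves_def using K
    by (intro exI[of _ "(`) h ` \<K>"]) auto
qed

lemma straight_atI:
  assumes "open U" "p \<in> U" "P \<inter> U = range (\<lambda>t. p + t *\<^sub>R u) \<inter> U"
  shows "straight_at P p u"
proof -
  obtain e where "e > 0" "ball p e \<subseteq> U" using assms openE by blast
  then show ?thesis unfolding straight_at_def using assms(3) by (intro exI[of _ e]) blast
qed

lemma straight_at_cong:
  assumes "straight_at P p u" "open U" "p \<in> U" "P \<inter> U = P' \<inter> U"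
  shows "straight_at P' p u"
proof -
  obtain e where "e > 0" "P \<inter> ball p e = range (\<lambda>t. p + t *\<^sub>R u) \<inter> ball p e"
    using assms(1) straight_at_def by blast
  then show ?thesis using assms(2-)
    by (intro straight_atI[of "ball p e \<inter> U"]) auto
qed

lemma kink_eq_strand_outside:
  "fst w \<notin> square 3 \<Longrightarrow> w \<in> kink \<longleftrightarrow> w \<in> strand"
  by (cases w) (auto simp: kink_def strand_def square_def split: prod.splits)

lemma kink_over_crossing:
  assumes "w \<in> kink" "fst w = (0, 2/3)" shows "w = ((0, 2/3), 4/3) \<or> w = ((0, 2/3), - 4/3)"
proof -
  obtain z where w: "w = ((0, 2/3), z)" using assms(2) by (metis prod.collapse)
  show ?thesis using assms(1) by (simp add: kink_def w)
qed

text \<open>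
  Any two of the four pieces of the kink lie over lines with at most one common point, and apart from
  the bends, where consecutive pieces meet in space, the only such point on the kink is the
  crossing.
\<close>

lemma kink_double_point:
  assumes "w \<in> kink" "w' \<in> kink" "fst w = fst w'" "w \<noteq> w'"
  shows "fst w = (0, 2/3)" and "w = ((0, 2/3), 4/3) \<and> w' = ((0, 2/3), - 4/3) \<or>
    w = ((0, 2/3), - 4/3) \<and> w' = ((0, 2/3), 4/3)"
proof -
  obtain x y z z' where w: "w = ((x, y), z)" "w' = ((x, y), z')" and ne: "z \<noteq> z'"
    using assms(3,4) by (metis prod.collapse)
  have c: "z = 0 \<and> y = 0 \<and> 2 \<le> \<bar>x\<bar> \<or> z = 2 * y \<and> 3 * y = x + 2 \<and> -2 \<le> x \<and> x \<le> 1 \<or>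
     z = 2 * x \<and> y = 1 \<and> \<bar>x\<bar> \<le> 1 \<or> z = - 2 * y \<and> 3 * y = 2 - x \<and> -1 \<le> x \<and> x \<le> 2" if "((x, y), z) \<in> kink" for z
    using that unfolding kink_def mem_Collect_eq case_prod_conv by blast
  have "x = 0 \<and> y = 2/3"
    using c[OF assms(1)[unfolded w]] c[OF assms(2)[unfolded w]] ne
    by (elim disjE conjE; intro conjI; linarith)
  then show "fst w = (0, 2/3)" by (simp add: w)
  then show "w = ((0, 2/3), 4/3) \<and> w' = ((0, 2/3), - 4/3) \<or> w = ((0, 2/3), - 4/3) \<and> w' = ((0, 2/3), 4/3)"
    using kink_over_crossing[OF assms(1)] kink_over_crossing[OF assms(2)] assms(3,4) by auto
qed

lemma kink_narrow: "w \<in> kink \<Longrightarrow> 0 \<le> snd (fst w) \<and> snd (fst w) \<le> 1"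
  by (auto simp: kink_def)

lemma segment_union_kink: "segment_union (kink \<inter> {w. \<bar>fst (fst w)\<bar> \<le> 3})"
proof -
  have seg: "((x, y), z) \<in> closed_segment ((a, b), c) ((a', b'), c') \<longleftrightarrow>
     (\<exists>t. 0 \<le> t \<and> t \<le> 1 \<and> x = (1 - t) * a + t * a' \<and> y = (1 - t) * b + t * b' \<and> z = (1 - t) * c + t * c')"
    for x y z a b c a' b' c' :: real
    by (auto simp: in_segment)
  have s1: "{((x::real, y::real), z::real). y = 0 \<and> z = 0 \<and> -3 \<le> x \<and> x \<le> -2} = closed_segment ((-3, 0), 0) ((-2, 0), 0)"
  proof -
    have eq: "y = 0 \<and> z = 0 \<and> -3 \<le> x \<and> x \<le> -2 \<longleftrightarrow> ((x, y), z) \<in> closed_segment ((-3, 0), 0) ((-2, 0), 0)" for x y z :: real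
      unfolding seg by (intro iffI exI[of _ "x + 3"]) (auto simp: field_simps)
    show ?thesis by (simp only: Set.set_eq_iff split_paired_All mem_Collect_eq case_prod_conv) (intro allI eq)
  qed
  have s2: "{((x::real, y::real), z::real). y = 0 \<and> z = 0 \<and> 2 \<le> x \<and> x \<le> 3} = closed_segment ((2, 0), 0) ((3, 0), 0)"
  proof -
    have eq: "y = 0 \<and> z = 0 \<and> 2 \<le> x \<and> x \<le> 3 \<longleftrightarrow> ((x, y), z) \<in> closed_segment ((2, 0), 0) ((3, 0), 0)" for x y z :: real
      unfolding seg by (intro iffI exI[of _ "x - 2"]) (auto simp: field_simps)
    show ?thesis by (simp only: Set.set_eq_iff split_paired_All mem_Collect_eq case_prod_conv) (intro allI eq)
  qed
  have s3: "{((x::real, y::real), z::real). 3 * y = x + 2 \<and> z = 2 * y \<and> -2 \<le> x \<and> x \<le> 1} = closed_segment ((-2, 0), 0) ((1, 1), 2)"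
  proof -
    have eq: "3 * y = x + 2 \<and> z = 2 * y \<and> -2 \<le> x \<and> x \<le> 1 \<longleftrightarrow> ((x, y), z) \<in> closed_segment ((-2, 0), 0) ((1, 1), 2)" for x y z :: real
      unfolding seg by (intro iffI exI[of _ "(x + 2) / 3"]) (auto simp: field_simps)
    show ?thesis by (simp only: Set.set_eq_iff split_paired_All mem_Collect_eq case_prod_conv) (intro allI eq)
  qed
  have s4: "{((x::real, y::real), z::real). y = 1 \<and> z = 2 * x \<and> \<bar>x\<bar> \<le> 1} = closed_segment ((-1, 1), -2) ((1, 1), 2)"
  proof -
    have eq: "y = 1 \<and> z = 2 * x \<and> \<bar>x\<bar> \<le> 1 \<longleftrightarrow> ((x, y), z) \<in> closed_segment ((-1, 1), -2) ((1, 1), 2)" for x y z :: real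
      unfolding seg by (intro iffI exI[of _ "(x + 1) / 2"]) (auto simp: field_simps)
    show ?thesis by (simp only: Set.set_eq_iff split_paired_All mem_Collect_eq case_prod_conv) (intro allI eq)
  qed
  have s5: "{((x::real, y::real), z::real). 3 * y = 2 - x \<and> z = - 2 * y \<and> -1 \<le> x \<and> x \<le> 2} = closed_segment ((-1, 1), -2) ((2, 0), 0)"
  proof -
    have eq: "3 * y = 2 - x \<and> z = - 2 * y \<and> -1 \<le> x \<and> x \<le> 2 \<longleftrightarrow> ((x, y), z) \<in> closed_segment ((-1, 1), -2) ((2, 0), 0)" for x y z :: real
      unfolding seg by (intro iffI exI[of _ "(x + 1) / 3"]) (auto simp: field_simps)
    show ?thesis by (simp only: Set.set_eq_iff split_paired_All mem_Collect_eq case_prod_conv) (intro allI eq)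
  qed
  have "kink \<inter> {w. \<bar>fst (fst w)\<bar> \<le> 3} =
    {((x, y), z). y = 0 \<and> z = 0 \<and> -3 \<le> x \<and> x \<le> -2} \<union> {((x, y), z). y = 0 \<and> z = 0 \<and> 2 \<le> x \<and> x \<le> 3} \<union>
    {((x, y), z). 3 * y = x + 2 \<and> z = 2 * y \<and> -2 \<le> x \<and> x \<le> 1} \<union>
    {((x, y), z). y = 1 \<and> z = 2 * x \<and> \<bar>x\<bar> \<le> 1} \<union>
    {((x, y), z). 3 * y = 2 - x \<and> z = - 2 * y \<and> -1 \<le> x \<and> x \<le> 2}"
    by (auto simp: kink_def)
  then show ?thesis
    unfolding s1 s2 s3 s4 s5 by (simp only: segment_union_Un segment_union_segment)
qed

lemma frame_direction: "frame c u (w + t *\<^sub>R d) = frame c u w + t *\<^sub>R frame 0 u d"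
  by (simp add: frame_def plane_frame_def prod_eq_iff algebra_simps)

section \<open>Inserting kinks into a diagram\<close>

text \<open>
  Inside the prism of half width 7 the set \<open>P\<close> is the copy of \<open>T\<close> in the frame, and nothing else lies
  above or below. The kink and the strand differ only inside the prism of half width 3, and the rest
  of the larger prism is a margin around the place of the move.
\<close>

definition carries :: "space set \<Rightarrow> ((real \<times> real) \<times> real) set \<Rightarrow> space \<Rightarrow> space \<Rightarrow> bool" where
  "carries P T c u \<longleftrightarrow> fst u \<noteq> 0 \<and> P \<inter> prism c u 7 = frame c u ` T \<inter> prism c u 7"

lemma straight_at_frame:
  assumes T: "carries P T c u"
    and U: "open U" "w \<in> U" "U \<subseteq> {w. fst w \<in> square 7}" "T \<inter> U = range (\<lambda>t. w + t *\<^sub>R d) \<inter> U"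
  shows "straight_at P (frame c u w) (frame 0 u d)"
proof -
  have u: "fst u \<noteq> 0" and P: "P \<inter> prism c u 7 = frame c u ` T \<inter> prism c u 7"
    using T by (auto simp: carries_def)
  have eq: "coord c u -` U = frame c u ` U"
    by (rule Set.set_eqI) (simp only: vimage_eq frame_image_iff[OF u])
  have op: "open (frame c u ` U)"
    unfolding eq[symmetric] using U(1) continuous_on_coord open_vimage by blast
  have "frame c u ` U \<subseteq> prism c u 7"
    using U(3) u by (force simp: prism_def)
  then have "P \<inter> frame c u ` U = frame c u ` T \<inter> frame c u ` U" using P by blast
  also have "\<dots> = frame c u ` (T \<inter> U)" using u by (auto simp: image_iff)
  also have "\<dots> = frame c u ` range (\<lambda>t. w + t *\<^sub>R d) \<inter> frame c u ` U"
    unfolding U(4) using u by (auto simp: image_iff)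
  also have "frame c u ` range (\<lambda>t. w + t *\<^sub>R d) = range (\<lambda>t. frame c u w + t *\<^sub>R frame 0 u d)"
    by (simp only: image_image frame_direction)
  finally have "P \<inter> frame c u ` U = range (\<lambda>t. frame c u w + t *\<^sub>R frame 0 u d) \<inter> frame c u ` U" .
  then show ?thesis using U(2) op by (intro straight_atI[of "frame c u ` U"]) auto
qed

text \<open>
  Near the two points of the crossing only the upper piece, with direction \<open>((3, 1), 2)\<close>, or only
  the lower one, with direction \<open>((3, -1), 2)\<close>, is present: the neighbourhoods in the proof tell the
  two apart by the sign of the height.
\<close>

lemma carries_kink_transverse:
  assumes "carries P kink c u"
  shows "straight_at P (frame c u ((0, 2/3), 4/3)) (frame 0 u ((3, 1), 2))"
    and "straight_at P (frame c u ((0, 2/3), - 4/3)) (frame 0 u ((3, -1), 2))"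
    and "\<not> collinear {0, fst (frame 0 u ((3, 1), 2)), fst (frame 0 u ((3, -1), 2))}"
proof -
  define U where "U = (\<lambda>z0. {w::(real \<times> real) \<times> real. \<bar>fst (fst w)\<bar> < 1/2 \<and> 1/3 < snd (fst w) \<and> snd (fst w) < 1 \<and> 0 < z0 * snd w})"
  have op: "open (U z0)" for z0
    unfolding U_def by (intro open_Collect_conj open_Collect_less continuous_intros)
  have sub: "U z0 \<subseteq> {w. fst w \<in> square 7}" for z0 by (auto simp: U_def square_def)
  have k1: "kink \<inter> U 1 = range (\<lambda>t. ((0, 2/3), 4/3) + t *\<^sub>R ((3, 1), 2)) \<inter> U 1"
  proof (intro Set.set_eqI)
    fix w :: "(real \<times> real) \<times> real"
    obtain x y z where w: "w = ((x, y), z)" by (metis surj_pair)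
    have "w \<in> range (\<lambda>t. ((0, 2/3), 4/3) + t *\<^sub>R ((3, 1), 2)) \<longleftrightarrow> (\<exists>t. x = 3 * t \<and> y = 2/3 + t \<and> z = 4/3 + 2 * t)"
      by (simp add: image_iff w mult.commute)
    also have "\<dots> \<longleftrightarrow> 3 * y = x + 2 \<and> z = 2 * y"
      by (auto intro: exI[of _ "x / 3"])
    finally have "w \<in> range (\<lambda>t. ((0, 2/3), 4/3) + t *\<^sub>R ((3, 1), 2)) \<longleftrightarrow> 3 * y = x + 2 \<and> z = 2 * y" .
    moreover have "w \<in> kink \<longleftrightarrow> 3 * y = x + 2 \<and> z = 2 * y" if "w \<in> U 1"
    proof -
      have "\<bar>x\<bar> < 1/2" "1/3 < y" "y < 1" "0 < z" using that by (simp_all add: U_def w)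
      then show ?thesis unfolding w kink_def mem_Collect_eq case_prod_conv by linarith
    qed
    ultimately show "w \<in> kink \<inter> U 1 \<longleftrightarrow> w \<in> range (\<lambda>t. ((0, 2/3), 4/3) + t *\<^sub>R ((3, 1), 2)) \<inter> U 1"
      by blast
  qed
  have k2: "kink \<inter> U (-1) = range (\<lambda>t. ((0, 2/3), - 4/3) + t *\<^sub>R ((3, -1), 2)) \<inter> U (-1)"
  proof (intro Set.set_eqI)
    fix w :: "(real \<times> real) \<times> real"
    obtain x y z where w: "w = ((x, y), z)" by (metis surj_pair)
    have "w \<in> range (\<lambda>t. ((0, 2/3), - 4/3) + t *\<^sub>R ((3, -1), 2)) \<longleftrightarrow> (\<exists>t. x = 3 * t \<and> y = 2/3 - t \<and> z = - 4/3 + 2 * t)"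
      by (simp add: image_iff w mult.commute)
    also have "\<dots> \<longleftrightarrow> 3 * y = 2 - x \<and> z = - 2 * y"
      by (auto intro: exI[of _ "x / 3"])
    finally have "w \<in> range (\<lambda>t. ((0, 2/3), - 4/3) + t *\<^sub>R ((3, -1), 2)) \<longleftrightarrow> 3 * y = 2 - x \<and> z = - 2 * y" .
    moreover have "w \<in> kink \<longleftrightarrow> 3 * y = 2 - x \<and> z = - 2 * y" if "w \<in> U (-1)"
    proof -
      have "\<bar>x\<bar> < 1/2" "1/3 < y" "y < 1" "z < 0" using that by (simp_all add: U_def w)
      then show ?thesis unfolding w kink_def mem_Collect_eq case_prod_conv by linarith
    qed
    ultimately show "w \<in> kink \<inter> U (-1) \<longleftrightarrow> w \<in> range (\<lambda>t. ((0, 2/3), - 4/3) + t *\<^sub>R ((3, -1), 2)) \<inter> U (-1)"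
      by blast
  qed
  show "straight_at P (frame c u ((0, 2/3), 4/3)) (frame 0 u ((3, 1), 2))"
    by (rule straight_at_frame[OF assms op _ sub k1]) (simp add: U_def)
  show "straight_at P (frame c u ((0, 2/3), - 4/3)) (frame 0 u ((3, -1), 2))"
    by (rule straight_at_frame[OF assms op _ sub k2]) (simp add: U_def)
next
  define a where "a = fst u"
  have a: "a \<bullet> a > 0" using assms by (simp add: carries_def a_def)
  have e: "fst (frame 0 u ((3, 1), 2)) = 3 *\<^sub>R a + rot a" "fst (frame 0 u ((3, -1), 2)) = 3 *\<^sub>R a - rot a"
    by (simp_all add: plane_frame_def a_def)
  show "\<not> collinear {0, fst (frame 0 u ((3, 1), 2)), fst (frame 0 u ((3, -1), 2))}"
  proof
    assume "collinear {0, fst (frame 0 u ((3, 1), 2)), fst (frame 0 u ((3, -1), 2))}"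
    then consider "3 *\<^sub>R a + rot a = 0" | "3 *\<^sub>R a - rot a = 0" | k where "3 *\<^sub>R a - rot a = k *\<^sub>R (3 *\<^sub>R a + rot a)"
      unfolding e collinear_lemma by metis
    then show False
    proof cases
      case 1
      then have "(3 *\<^sub>R a + rot a) \<bullet> a = 0" by simp
      then show False using a by (simp add: inner_add_left)
    next
      case 2
      then have "(3 *\<^sub>R a - rot a) \<bullet> a = 0" by simp
      then show False using a by (simp add: inner_diff_left)
    next
      case 3
      have "3 * (a \<bullet> a) = k * (3 * (a \<bullet> a))"
        using arg_cong[OF 3, of "\<lambda>v. v \<bullet> a"] by (simp add: inner_add_left inner_diff_left)
      moreover have "- (a \<bullet> a) = k * (a \<bullet> a)"
        using arg_cong[OF 3, of "\<lambda>v. v \<bullet> rot a"] by (simp add: inner_add_left inner_diff_left)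
      ultimately show False using a by auto
    qed
  qed
qed

text \<open>
  Crossings and multiplicities of double points are properties of the fibres of the projection, and
  over the square these are the fibres of the model.
\<close>

lemma carries_fibre:
  assumes "carries P T c u" "plane_coord (fst c) (fst u) x \<in> square 7"
  shows "{p \<in> P. fst p = x} = frame c u ` {w \<in> T. fst w = plane_coord (fst c) (fst u) x}"
proof -
  have u: "fst u \<noteq> 0" using assms by (auto simp: carries_def)
  show ?thesis
  proof (intro Set.set_eqI)
    fix p
    have "p \<in> P \<and> fst p = x \<longleftrightarrow> p \<in> P \<inter> prism c u 7 \<and> fst p = x"
      using assms(2) by (auto simp: prism_def)
    also have "\<dots> \<longleftrightarrow> p \<in> frame c u ` T \<inter> prism c u 7 \<and> fst p = x"
      using assms by (simp add: carries_def)
    also have "\<dots> \<longleftrightarrow> coord c u p \<in> T \<and> fst (coord c u p) = plane_coord (fst c) (fst u) x"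
      using assms(2) u by (auto simp: prism_def frame_image_iff)
        (metis plane_frame_plane_coord)
    also have "\<dots> \<longleftrightarrow> p \<in> frame c u ` {w \<in> T. fst w = plane_coord (fst c) (fst u) x}"
      by (simp only: frame_image_iff[OF u] mem_Collect_eq)
    finally show "p \<in> {p \<in> P. fst p = x} \<longleftrightarrow> p \<in> frame c u ` {w \<in> T. fst w = plane_coord (fst c) (fst u) x}" by simp
  qed
qed

lemma kink_fibre: "finite {w \<in> kink. fst w = v} \<and> card {w \<in> kink. fst w = v} \<le> 2"
proof -
  have "\<exists>a b. {w \<in> kink. fst w = v} \<subseteq> {a, b}"
  proof (cases "\<exists>w w'. w \<in> kink \<and> w' \<in> kink \<and> fst w = v \<and> fst w' = v \<and> w \<noteq> w'")
    case True
    then have "v = (0, 2/3)" using kink_double_point(1) by metis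
    then have "w \<in> {(v, 4/3), (v, - 4/3)}" if "w \<in> {w \<in> kink. fst w = v}" for w
      using kink_over_crossing[of w] that by simp
    then have "{w \<in> kink. fst w = v} \<subseteq> {(v, 4/3), (v, - 4/3)}" by (rule subsetI)
    then show ?thesis by blast
  next
    case False
    then show ?thesis by blast
  qed
  then obtain a b where ab: "{w \<in> kink. fst w = v} \<subseteq> {a, b}" by blast
  then have "card {w \<in> kink. fst w = v} \<le> card {a, b}" by (intro card_mono) auto
  also have "\<dots> \<le> 2" by (simp add: card_insert_if)
  finally show ?thesis using ab finite_subset by blast
qed

lemma carries_fibreE:
  assumes "carries P T c u" "plane_coord (fst c) (fst u) x \<in> square 7" "p \<in> P" "fst p = x"
  obtains w where "w \<in> T" "fst w = plane_coord (fst c) (fst u) x" "p = frame c u w"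
proof -
  have "p \<in> frame c u ` {w \<in> T. fst w = plane_coord (fst c) (fst u) x}"
    using carries_fibre[OF assms(1,2)] assms(3,4) by (metis (mono_tags, lifting) mem_Collect_eq)
  then show ?thesis
  proof (rule imageE)
    fix w assume "p = frame c u w" "w \<in> {w \<in> T. fst w = plane_coord (fst c) (fst u) x}"
    then show thesis using that[of w] by simp
  qed
qed

lemma crossingsE:
  assumes "x \<in> crossings P"
  obtains p q where "p \<in> P" "fst p = x" "q \<in> P" "fst q = x" "p \<noteq> q"
  using assms unfolding crossings_def mem_Collect_eq by (elim bexE conjE) rule

lemma carries_kink_crossing:
  assumes "carries P kink c u" "plane_coord (fst c) (fst u) x \<in> square 7"
  shows "x \<in> crossings P \<longleftrightarrow> plane_coord (fst c) (fst u) x = (0, 2/3)"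
proof
  assume "x \<in> crossings P"
  then obtain p q where pq: "p \<in> P" "fst p = x" "q \<in> P" "fst q = x" "p \<noteq> q"
    by (rule crossingsE)
  obtain w where "w \<in> kink" "fst w = plane_coord (fst c) (fst u) x" "p = frame c u w"
    using carries_fibreE[OF assms pq(1,2)] .
  moreover obtain w' where "w' \<in> kink" "fst w' = plane_coord (fst c) (fst u) x" "q = frame c u w'"
    using carries_fibreE[OF assms pq(3,4)] .
  ultimately show "plane_coord (fst c) (fst u) x = (0, 2/3)"
    using kink_double_point(1)[of w w'] pq(5) by auto
next
  assume x: "plane_coord (fst c) (fst u) x = (0, 2/3)"
  have u: "fst u \<noteq> 0" using assms by (auto simp: carries_def)
  have fib: "frame c u w \<in> P \<and> fst (frame c u w) = x" if "w \<in> kink" "fst w = (0, 2/3)" for w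
  proof -
    have "frame c u w \<in> frame c u ` {w \<in> kink. fst w = plane_coord (fst c) (fst u) x}"
      using that x by (intro imageI) simp
    then show ?thesis unfolding carries_fibre[OF assms, symmetric] mem_Collect_eq .
  qed
  have "((0, 2/3), 4/3) \<in> kink" "((0, 2/3), - 4/3) \<in> kink" by (simp_all add: kink_def)
  then have "frame c u ((0, 2/3), 4/3) \<in> P \<and> fst (frame c u ((0, 2/3), 4/3)) = x"
    "frame c u ((0, 2/3), - 4/3) \<in> P \<and> fst (frame c u ((0, 2/3), - 4/3)) = x"
    by (intro fib; simp)+
  moreover have "frame c u ((0, 2/3), 4/3) \<noteq> frame c u ((0, 2/3), - 4/3)" using u by simp
  ultimately show "x \<in> crossings P" unfolding crossings_def mem_Collect_eq by metis
qed

text \<open>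
  This is the type I Reidemeister move. The result is a link because it is the image under a
  homeomorphism of space, and polygonal because only segments are exchanged. Over the prism its
  double points are those of the kink, and everywhere else those of \<open>P\<close>, around which the two sets
  agree.
\<close>

lemma insert_kink:
  assumes P: "link_diagram P" and S: "carries P strand c u"
  obtains P' where "link_diagram P'" "ambient_isotopic P P'"
    "P' - prism c u 3 = P - prism c u 3" "carries P' kink c u"
proof -
  have u: "fst u \<noteq> 0" and PS: "P \<inter> prism c u 7 = frame c u ` strand \<inter> prism c u 7"
    using S by (auto simp: carries_def)
  obtain k where k: "isotopic_to_id k" "k ` strand = kink" "\<And>w. fst w \<notin> square 5 \<Longrightarrow> k w = w"
    using kink_isotopy by blast
  define h where "h = frame c u \<circ> k \<circ> coord c u"
  have h: "isotopic_to_id h"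
    unfolding h_def by (intro isotopic_to_id_conjugate k homeomorphism_frame u)
  obtain g where hg: "homeomorphism UNIV UNIV h g" using isotopic_to_id_homeomorphism[OF h] .
  have inj: "inj h" using hg by (metis UNIV_I homeomorphism_apply1 injI)
  have surj: "surj h" using hg by (simp add: homeomorphism_def)
  have hid: "h q = q" if "q \<notin> prism c u 7" for q
    using that k(3)[of "coord c u q"] u by (auto simp: h_def prism_def square_def)
  have "h ` (- prism c u 7) = - prism c u 7" using hid by force
  then have hcol: "h ` prism c u 7 = prism c u 7"
    using bij_image_Compl_eq[of h "prism c u 7"] inj surj by (auto simp: bij_def)
  have hS: "h ` frame c u ` strand = frame c u ` kink"
    unfolding h_def k(2)[symmetric] using u by (simp add: image_image)
  define P' where "P' = h ` P"
  have P'1: "P' \<inter> prism c u 7 = frame c u ` kink \<inter> prism c u 7"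
    unfolding P'_def hS[symmetric]
    by (subst (1 2) hcol[symmetric]) (simp only: image_Int[OF inj, symmetric] PS)
  have "h ` (P - prism c u 7) = P - prism c u 7" using hid by force
  then have P'7: "P' - prism c u 7 = P - prism c u 7"
    unfolding P'_def using image_set_diff[OF inj, of P "prism c u 7"] hcol by simp
  have C37: "prism c u 3 \<subseteq> prism c u 7" by (auto simp: prism_def square_def)
  have "p \<in> P' \<longleftrightarrow> p \<in> P" if p: "p \<notin> prism c u 3" for p
  proof (cases "p \<in> prism c u 7")
    case True
    have "p \<in> P' \<longleftrightarrow> coord c u p \<in> kink" using True P'1 frame_image_iff[OF u] by blast
    also have "\<dots> \<longleftrightarrow> coord c u p \<in> strand" using p kink_eq_strand_outside by (auto simp: prism_def)
    also have "\<dots> \<longleftrightarrow> p \<in> P" using True PS frame_image_iff[OF u] by blast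
    finally show ?thesis .
  qed (use P'7 in blast)
  then have P'3: "P' - prism c u 3 = P - prism c u 3" by blast
  have K: "carries P' kink c u" using u P'1 by (simp add: carries_def)
  have P'eq: "P' = (P - prism c u 3) \<union> frame c u ` (kink \<inter> {w. \<bar>fst (fst w)\<bar> \<le> 3})"
  proof -
    have "frame c u ` (kink \<inter> {w. \<bar>fst (fst w)\<bar> \<le> 3}) \<subseteq> P'"
    proof
      fix p assume p: "p \<in> frame c u ` (kink \<inter> {w. \<bar>fst (fst w)\<bar> \<le> 3})"
      then have "coord c u p \<in> kink" "\<bar>fst (fst (coord c u p))\<bar> \<le> 3" using frame_image_iff[OF u] by auto
      moreover from this have "fst (coord c u p) \<in> square 7"
        using kink_narrow[of "coord c u p"] by (simp add: square_def)
      then have "p \<in> prism c u 7" by (simp add: prism_def)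
      moreover have "p \<in> frame c u ` kink" using \<open>coord c u p \<in> kink\<close> frame_image_iff[OF u] by metis
      ultimately show "p \<in> P'" using P'1 by blast
    qed
    moreover have "P' \<inter> prism c u 3 \<subseteq> frame c u ` (kink \<inter> {w. \<bar>fst (fst w)\<bar> \<le> 3})"
    proof
      fix p assume p: "p \<in> P' \<inter> prism c u 3"
      then have "p \<in> frame c u ` kink" using P'1 C37 by blast
      moreover have "\<bar>fst (fst (coord c u p))\<bar> \<le> 3" using p by (simp add: prism_def square_def)
      ultimately show "p \<in> frame c u ` (kink \<inter> {w. \<bar>fst (fst w)\<bar> \<le> 3})"
        unfolding frame_image_iff[OF u] Int_iff mem_Collect_eq by (rule conjI)
    qed
    ultimately show ?thesis using P'3 by blast
  qed
  have poly: "polygonal_link P" and fin: "finite (crossings P)" and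
    fib: "\<And>x. finite {p \<in> P. fst p = x} \<and> card {p \<in> P. fst p = x} \<le> 2" and
    trans: "\<And>p q. p \<in> P \<Longrightarrow> q \<in> P \<Longrightarrow> p \<noteq> q \<Longrightarrow> fst p = fst q \<Longrightarrow>
        \<exists>u v. straight_at P p u \<and> straight_at P q v \<and> \<not> collinear {0, fst u, fst v}"
    using P unfolding link_diagram_def by blast+
  have "segment_union P" using poly unfolding polygonal_link_def segment_union_def by blast
  then have "segment_union P'"
    unfolding P'eq by (intro segment_union_Un segment_union_Diff_prism segment_union_frame segment_union_kink)
  then have poly': "polygonal_link P'"
    using disjoint_closed_curves_homeomorphism[OF _ hg] poly
    by (auto simp: polygonal_link_def segment_union_def P'_def)
  have same_fibre: "{p \<in> P'. fst p = x} = {p \<in> P. fst p = x}" if "plane_coord (fst c) (fst u) x \<notin> square 7" for x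
  proof -
    have "p \<in> P' \<longleftrightarrow> p \<in> P" if "fst p = x" for p
      using P'7 that \<open>plane_coord (fst c) (fst u) x \<notin> square 7\<close> by (auto simp: prism_def)
    then show ?thesis by blast
  qed
  have "crossings P' \<subseteq> crossings P \<union> {plane_frame (fst c) (fst u) (0, 2/3)}"
  proof
    fix x assume x: "x \<in> crossings P'"
    show "x \<in> crossings P \<union> {plane_frame (fst c) (fst u) (0, 2/3)}"
    proof (cases "plane_coord (fst c) (fst u) x \<in> square 7")
      case True
      then show ?thesis using carries_kink_crossing[OF K] x u by (metis UnI2 insertI1 plane_frame_plane_coord)
    next
      case False
      obtain p q where pq: "p \<in> P'" "fst p = x" "q \<in> P'" "fst q = x" "p \<noteq> q"
        using x by (rule crossingsE)
      have "p \<in> {p \<in> P'. fst p = x}" "q \<in> {p \<in> P'. fst p = x}" using pq by simp_all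
      then have "p \<in> P" "q \<in> P" unfolding same_fibre[OF False] by simp_all
      then have "x \<in> crossings P" using pq unfolding crossings_def mem_Collect_eq by metis
      then show ?thesis by simp
    qed
  qed
  then have fin': "finite (crossings P')" using fin finite_subset by blast
  have fib': "finite {p \<in> P'. fst p = x} \<and> card {p \<in> P'. fst p = x} \<le> 2" for x
  proof (cases "plane_coord (fst c) (fst u) x \<in> square 7")
    case True
    have "finite {w \<in> kink. fst w = plane_coord (fst c) (fst u) x}" "card {w \<in> kink. fst w = plane_coord (fst c) (fst u) x} \<le> 2"
      using kink_fibre by auto
    then show ?thesis
      unfolding carries_fibre[OF K True] using card_image_le order_trans by blast
  qed (use same_fibre fib in simp)
  have trans': "\<exists>u v. straight_at P' p u \<and> straight_at P' q v \<and> \<not> collinear {0, fst u, fst v}"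
    if pq: "p \<in> P'" "q \<in> P'" "p \<noteq> q" "fst p = fst q" for p q
  proof (cases "plane_coord (fst c) (fst u) (fst p) \<in> square 7")
    case True
    obtain w where w1: "w \<in> kink" "fst w = plane_coord (fst c) (fst u) (fst p)" "p = frame c u w"
      using carries_fibreE[OF K True pq(1) refl] .
    obtain w' where w2: "w' \<in> kink" "fst w' = plane_coord (fst c) (fst u) (fst p)" "q = frame c u w'"
      using carries_fibreE[OF K True pq(2) pq(4)[symmetric]] .
    have w: "w \<in> kink" "w' \<in> kink" "fst w = fst w'" "p = frame c u w" "q = frame c u w'"
      using w1 w2 by simp_all
    have ne: "w \<noteq> w'" using pq(3) w(4,5) by blast
    note t = carries_kink_transverse[OF K]
    have t': "\<not> collinear {0, fst (frame 0 u ((3, -1), 2)), fst (frame 0 u ((3, 1), 2))}"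
      using t(3) by (metis insert_commute)
    from kink_double_point(2)[OF w(1-3) ne] show ?thesis
    proof (elim disjE conjE)
      assume "w = ((0, 2/3), 4/3)" "w' = ((0, 2/3), - 4/3)"
      then show ?thesis unfolding w(4,5) using t by metis
    next
      assume "w = ((0, 2/3), - 4/3)" "w' = ((0, 2/3), 4/3)"
      then show ?thesis unfolding w(4,5) using t(1,2) t' by metis
    qed
  next
    case False
    have "p \<in> {r \<in> P'. fst r = fst p}" "q \<in> {r \<in> P'. fst r = fst p}" using pq by simp_all
    then have "p \<in> P" "q \<in> P" unfolding same_fibre[OF False] by simp_all
    then obtain v v' where v: "straight_at P p v" "straight_at P q v'" "\<not> collinear {0, fst v, fst v'}"
      using trans pq by blast
    define U where "U = {q. \<not> (\<bar>fst (fst (coord c u q))\<bar> \<le> 3 \<and> \<bar>snd (fst (coord c u q))\<bar> \<le> 3)}"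
    have "closed {q. \<bar>fst (fst (coord c u q))\<bar> \<le> 3 \<and> \<bar>snd (fst (coord c u q))\<bar> \<le> 3}"
      by (intro closed_Collect_conj closed_Collect_le continuous_intros continuous_on_coord)
    then have "open U" unfolding U_def Collect_neg_eq by (rule open_Compl)
    moreover have "p \<in> U" "q \<in> U" using False pq(4) by (auto simp: U_def square_def)
    moreover have "P \<inter> U = P' \<inter> U"
    proof -
      have "U \<subseteq> - prism c u 3" by (auto simp: U_def prism_def square_def)
      then show ?thesis using P'3 by blast
    qed
    ultimately show ?thesis using straight_at_cong v by blast
  qed
  have "link_diagram P'"
    unfolding link_diagram_def using poly' fin' fib' trans' by blast
  moreover have "ambient_isotopic P P'" unfolding ambient_isotopic_iff P'_def using h by blast
  ultimately show ?thesis using that P'3 K by blast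
qed

lemma carries_cong:
  assumes "carries P T c u" "P \<inter> prism c u 7 = P' \<inter> prism c u 7"
  shows "carries P' T c u"
  using assms by (simp add: carries_def)

text \<open>
  Only the small prism of one kink has to avoid the large prism of another one. This permits rows of
  kinks whose large prisms overlap, which links the regions along the row.
\<close>

lemma insert_kinks:
  assumes "finite G" "link_diagram P"
    and "\<And>c u. (c, u) \<in> G \<Longrightarrow> carries P strand c u"
    and "\<And>c u c' u'. (c, u) \<in> G \<Longrightarrow> (c', u') \<in> G \<Longrightarrow> (c, u) \<noteq> (c', u') \<Longrightarrow>
      prism c u 3 \<inter> prism c' u' 7 = {}"
  shows "\<exists>P'. link_diagram P' \<and> ambient_isotopic P P' \<and>
    P' - (\<Union>(c, u)\<in>G. prism c u 3) = P - (\<Union>(c, u)\<in>G. prism c u 3) \<and>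
    (\<forall>(c, u)\<in>G. carries P' kink c u)"
  using assms
proof (induction G rule: finite_induct)
  case empty
  then show ?case using ambient_isotopic_refl by auto
next
  case (insert g G)
  obtain c u where g: "g = (c, u)" by (metis surj_pair)
  have "\<exists>P'. link_diagram P' \<and> ambient_isotopic P P' \<and>
    P' - (\<Union>(c, u)\<in>G. prism c u 3) = P - (\<Union>(c, u)\<in>G. prism c u 3) \<and>
    (\<forall>(c, u)\<in>G. carries P' kink c u)"
    by (rule insert.IH) (use insert.prems in blast)+
  then obtain P' where P': "link_diagram P'" "ambient_isotopic P P'"
    "P' - (\<Union>(c, u)\<in>G. prism c u 3) = P - (\<Union>(c, u)\<in>G. prism c u 3)"
    "\<forall>(c, u)\<in>G. carries P' kink c u"
    by (elim exE conjE)
  have disj: "prism c' u' 3 \<inter> prism c u 7 = {}" "prism c u 3 \<inter> prism c' u' 7 = {}" if "(c', u') \<in> G" for c' u'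
    using insert.prems(3)[of c' u' c u] insert.prems(3)[of c u c' u'] that insert.hyps g by auto
  have "prism c u 7 \<inter> (\<Union>(c, u)\<in>G. prism c u 3) = {}" using disj by blast
  then have "P \<inter> prism c u 7 = P' \<inter> prism c u 7" using P'(3) by blast
  moreover have "carries P strand c u" using insert.prems(2) g by simp
  ultimately have "carries P' strand c u" by (metis carries_cong)
  then obtain Q where Q: "link_diagram Q" "ambient_isotopic P' Q"
    "Q - prism c u 3 = P' - prism c u 3" "carries Q kink c u"
    using insert_kink P'(1) by blast
  have "carries Q kink c' u'" if "(c', u') \<in> G" for c' u'
  proof (rule carries_cong)
    show "carries P' kink c' u'" using P'(4) that by (auto dest: bspec)
    show "P' \<inter> prism c' u' 7 = Q \<inter> prism c' u' 7" using disj(2)[OF that] Q(3) by blast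
  qed
  moreover have "Q - (\<Union>(c, u)\<in>insert g G. prism c u 3) = P - (\<Union>(c, u)\<in>insert g G. prism c u 3)"
    using Q(3) P'(3) unfolding g by auto
  ultimately show ?case
    using Q P' ambient_isotopic_trans[OF P'(2) Q(2)] g by (intro exI[of _ Q]) auto
qed

section \<open>Regions near a kink\<close>

text \<open>
  The complement of the projected kink in the square consists of a part on each side of the strand
  and the triangle inside the loop. The vertices of the triangle are \<open>(0, 2/3)\<close>, \<open>(1, 1)\<close> and
  \<open>(-1, 1)\<close>.
\<close>

definition shadow :: "(real \<times> real) set" where
  "shadow = {(x, y).
     y = 0 \<and> 2 \<le> \<bar>x\<bar> \<or> 3 * y = x + 2 \<and> -2 \<le> x \<and> x \<le> 1 \<or>
     y = 1 \<and> \<bar>x\<bar> \<le> 1 \<or> 3 * y = 2 - x \<and> -1 \<le> x \<and> x \<le> 2}"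

lemma fst_kink: "fst ` kink = shadow"
proof
  show "fst ` kink \<subseteq> shadow" by (auto simp: kink_def shadow_def)
  show "shadow \<subseteq> fst ` kink"
  proof (clarify)
    fix x y assume "(x, y) \<in> shadow"
    then have "\<exists>z. ((x, y), z) \<in> kink" by (auto simp: shadow_def kink_def)
    then show "(x, y) \<in> fst ` kink" by force
  qed
qed

lemma fst_strand: "fst ` strand = {w. snd w = 0}"
  by (force simp: strand_def image_iff)

lemma carries_picture:
  assumes "carries P T c u" "w \<in> square 7"
  shows "plane_frame (fst c) (fst u) w \<in> fst ` P \<longleftrightarrow> w \<in> fst ` T"
proof -
  have "fst u \<noteq> 0" using assms(1) by (simp add: carries_def)
  then have "{p \<in> P. fst p = plane_frame (fst c) (fst u) w} = frame c u ` {v \<in> T. fst v = w}"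
    using carries_fibre[OF assms(1), of "plane_frame (fst c) (fst u) w"] assms(2) by simp
  moreover have "plane_frame (fst c) (fst u) w \<in> fst ` P \<longleftrightarrow> {p \<in> P. fst p = plane_frame (fst c) (fst u) w} \<noteq> {}"
    by force
  moreover have "w \<in> fst ` T \<longleftrightarrow> {v \<in> T. fst v = w} \<noteq> {}" by force
  ultimately show ?thesis by simp
qed

definition above :: "(real \<times> real) set" where
  "above = square 7 \<inter> {(x, y). 0 < y \<and>
     (1 < y \<or> (x < -1 \<or> 3 * y < 2 - x) \<and> x + 2 < 3 * y \<or> (1 < x \<or> 3 * y < x + 2) \<and> 2 - x < 3 * y)}"

definition below :: "(real \<times> real) set" where
  "below = square 7 \<inter> {(x, y). y < 0 \<or> 3 * y < x + 2 \<and> 3 * y < 2 - x}"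

definition loop_interior :: "(real \<times> real) set" where
  "loop_interior = {(x, y). y < 1 \<and> x + 2 < 3 * y \<and> 2 - x < 3 * y}"

lemma square_minus_shadow: "square 7 - shadow = above \<union> below \<union> loop_interior"
proof -
  have "(x, y) \<in> square 7 - shadow \<longleftrightarrow> (x, y) \<in> above \<union> below \<union> loop_interior" for x y
    unfolding shadow_def above_def below_def loop_interior_def square_def
      Diff_iff Un_iff Int_iff mem_Collect_eq case_prod_conv fst_conv snd_conv
    by (smt (verit))
  then show ?thesis by (metis subrelI subset_antisym)
qed

lemma convex_half_plane: "convex {w::real \<times> real. a * fst w + b * snd w < r}"
  using convex_halfspace_lt[of "(a, b)" r] by (simp add: inner_prod_def)

lemma open_square: "open (square r)"
  unfolding square_def by (intro open_Collect_conj open_Collect_less continuous_intros)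

lemma convex_square: "convex (square r)"
proof -
  have eq: "square r = {w. 1 * fst w + 0 * snd w < r} \<inter> {w. (- 1) * fst w + 0 * snd w < r} \<inter>
    {w. 0 * fst w + 1 * snd w < r} \<inter> {w. 0 * fst w + (- 1) * snd w < r}"
    by (auto simp: square_def)
  show ?thesis unfolding eq by (intro convex_Int convex_half_plane)
qed

lemma convex_loop_interior: "convex loop_interior"
proof -
  have eq: "loop_interior = {w. 0 * fst w + 1 * snd w < 1} \<inter> {w. 1 * fst w + (- 3) * snd w < - 2} \<inter>
    {w. (- 1) * fst w + (- 3) * snd w < - 2}"
    by (auto simp: loop_interior_def)
  show ?thesis unfolding eq by (intro convex_Int convex_half_plane)
qed

lemma connected_below: "connected below"
proof -
  define A where "A = square 7 \<inter> {w. 0 * fst w + 1 * snd w < 0}"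
  define B where "B = square 7 \<inter> {w. (- 1) * fst w + 3 * snd w < 2} \<inter> {w. 1 * fst w + 3 * snd w < 2}"
  have "below = A \<union> B" by (auto simp: below_def A_def B_def)
  moreover have "convex A" "convex B"
    unfolding A_def B_def by (intro convex_Int convex_half_plane convex_square)+
  moreover have "(0, -1) \<in> A \<inter> B" by (auto simp: A_def B_def square_def)
  ultimately show ?thesis by (metis connected_Un convex_connected empty_iff)
qed

text \<open>
  The loop overhangs the strand, so the part above the kink is a union of five convex sets: the half
  plane \<open>T\<close> over the loop, the pieces \<open>HL\<close> and \<open>HR\<close> beside it, and the pockets \<open>WL\<close> and \<open>WR\<close> that
  reach under it from the left and from the right.
\<close>

lemma connected_above: "connected above"
proof -
  define T where "T = square 7 \<inter> {w. 0 * fst w + (- 1) * snd w < - 1}"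
  define HL where "HL = square 7 \<inter> {w. 0 * fst w + (- 1) * snd w < 0} \<inter> {w. 1 * fst w + (- 3) * snd w < - 2} \<inter> {w. 1 * fst w + 0 * snd w < -1}"
  define WL where "WL = square 7 \<inter> {w. 0 * fst w + (- 1) * snd w < 0} \<inter> {w. 1 * fst w + (- 3) * snd w < - 2} \<inter> {w. 1 * fst w + 3 * snd w < 2}"
  define HR where "HR = square 7 \<inter> {w. 0 * fst w + (- 1) * snd w < 0} \<inter> {w. (- 1) * fst w + (- 3) * snd w < - 2} \<inter> {w. (- 1) * fst w + 0 * snd w < -1}"
  define WR where "WR = square 7 \<inter> {w. 0 * fst w + (- 1) * snd w < 0} \<inter> {w. (- 1) * fst w + (- 3) * snd w < - 2} \<inter> {w. (- 1) * fst w + 3 * snd w < 2}"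
  have "connected T" "connected HL" "connected WL" "connected HR" "connected WR"
    unfolding T_def HL_def WL_def HR_def WR_def
    by (intro convex_connected convex_Int convex_half_plane convex_square)+
  have p: "(-2, 1) \<in> HL" "(-2, 1) \<in> WL" "(2, 1) \<in> HR" "(2, 1) \<in> WR"
    "(-3, 2) \<in> T" "(-3, 2) \<in> HL" "(3, 2) \<in> T" "(3, 2) \<in> HR"
    by (auto simp: T_def HL_def WL_def HR_def WR_def square_def)
  have "connected (HL \<union> WL)" "connected (HR \<union> WR)"
    by (rule connected_Un; use p \<open>connected HL\<close> \<open>connected WL\<close> \<open>connected HR\<close> \<open>connected WR\<close> in blast)+
  have "connected (T \<union> (HL \<union> WL))"
    by (rule connected_Un; use p \<open>connected T\<close> \<open>connected (HL \<union> WL)\<close> in blast)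
  then have all: "connected ((T \<union> (HL \<union> WL)) \<union> (HR \<union> WR))"
    by (rule connected_Un; use p \<open>connected (HR \<union> WR)\<close> in blast)
  have "(x, y) \<in> (T \<union> (HL \<union> WL)) \<union> (HR \<union> WR) \<longleftrightarrow> (x, y) \<in> above" for x y
    unfolding above_def T_def HL_def WL_def HR_def WR_def square_def
      Un_iff Int_iff mem_Collect_eq case_prod_conv fst_conv snd_conv
    by (smt (verit))
  then have "(T \<union> (HL \<union> WL)) \<union> (HR \<union> WR) = above"
    by (metis subrelI subset_antisym)
  with all show ?thesis by metis
qed

lemma connected_plane_frame: "connected S \<Longrightarrow> connected (plane_frame c a ` S)"
  using connected_continuous_image continuous_on_plane_frame by blast

lemma plane_frame_vimage: "a \<noteq> 0 \<Longrightarrow> plane_frame c a ` S = plane_coord c a -` S"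
  using plane_frame_image_iff by blast

lemma open_plane_frame: "a \<noteq> 0 \<Longrightarrow> open S \<Longrightarrow> open (plane_frame c a ` S)"
  using open_vimage[OF _ continuous_on_plane_coord] by (simp add: plane_frame_vimage)

lemma closed_plane_frame: "a \<noteq> 0 \<Longrightarrow> closed S \<Longrightarrow> closed (plane_frame c a ` S)"
  using closed_vimage[OF _ continuous_on_plane_coord] by (simp add: plane_frame_vimage)

lemma region_contains:
  assumes "R \<in> regions P" "connected S" "S \<inter> fst ` P = {}" "S \<inter> R \<noteq> {}"
  shows "S \<subseteq> R"
  using assms components_maximal[of R "- fst ` P" S] unfolding regions_def by blast

lemma region_frontierI:
  assumes "R \<in> regions P" "x \<in> closure R" "x \<in> fst ` P"
  shows "x \<in> frontier R"
  using assms in_components_subset[of R "- fst ` P"] interior_subset[of R]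
  unfolding regions_def frontier_def by blast

text \<open>
  A connected set that leaves \<open>S\<close> meets the frontier of \<open>S\<close>, which a region cannot do when this
  frontier belongs to the picture.
\<close>

lemma region_eqI:
  assumes R: "R \<in> regions P" and S: "connected S" "S \<inter> fst ` P = {}" "S \<inter> R \<noteq> {}" "frontier S \<subseteq> fst ` P"
  shows "R = S"
proof (rule antisym)
  show "S \<subseteq> R" using region_contains R S by blast
  have "connected R" "R \<inter> fst ` P = {}"
    using R in_components_connected in_components_subset unfolding regions_def by blast+
  then show "R \<subseteq> S" using connected_Int_frontier[of R S] S by blast
qed

lemma frontier_loop:
  assumes a: "a \<noteq> 0"
  shows "frontier (plane_frame c a ` loop_interior) \<subseteq> plane_frame c a ` {(x, y). y \<le> 1 \<and> x + 2 \<le> 3 * y \<and> 2 - x \<le> 3 * y \<and>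
     (y = 1 \<or> 3 * y = x + 2 \<or> 3 * y = 2 - x)}" (is "_ \<subseteq> plane_frame c a ` ?F")
proof -
  let ?C = "{(x::real, y). y \<le> 1 \<and> x + 2 \<le> 3 * y \<and> 2 - x \<le> 3 * y}"
  have "closed ?C"
    unfolding case_prod_unfold
    by (intro closed_Collect_conj closed_Collect_le continuous_intros)
  then have "closure (plane_frame c a ` loop_interior) \<subseteq> plane_frame c a ` ?C"
    by (intro closure_minimal closed_plane_frame a image_mono) (auto simp: loop_interior_def)
  moreover have "open loop_interior"
    unfolding loop_interior_def case_prod_unfold
    by (intro open_Collect_conj open_Collect_less continuous_intros)
  then have "interior (plane_frame c a ` loop_interior) = plane_frame c a ` loop_interior"
    by (intro interior_open open_plane_frame a)
  ultimately have "frontier (plane_frame c a ` loop_interior) \<subseteq> plane_frame c a ` ?C - plane_frame c a ` loop_interior"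
    unfolding frontier_def by blast
  moreover have "plane_frame c a w \<in> plane_frame c a ` ?F" if "w \<in> ?C" "w \<notin> loop_interior" for w
    using that by (intro imageI) (auto simp: loop_interior_def)
  ultimately show ?thesis by blast
qed

lemma region_near_kink:
  assumes R: "R \<in> regions P" and K: "carries P kink c u"
    and meets: "R \<inter> plane_frame (fst c) (fst u) ` square 7 \<noteq> {}"
  shows "plane_frame (fst c) (fst u) ` above \<subseteq> R \<or> plane_frame (fst c) (fst u) ` below \<subseteq> R \<or>
    R = plane_frame (fst c) (fst u) ` loop_interior"
proof -
  let ?f = "plane_frame (fst c) (fst u)"
  have a: "fst u \<noteq> 0" using K by (simp add: carries_def)
  have pic: "?f w \<in> fst ` P \<longleftrightarrow> w \<in> shadow" if "w \<in> square 7" for w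
    using carries_picture[OF K that] by (simp add: fst_kink)
  obtain w where w: "w \<in> square 7" "?f w \<in> R" using meets by blast
  then have "?f w \<notin> fst ` P" using R in_components_subset unfolding regions_def by blast
  then have "w \<in> above \<union> below \<union> loop_interior" using pic w square_minus_shadow by blast
  then consider "w \<in> above" | "w \<in> below" | "w \<in> loop_interior" by blast
  then show ?thesis
  proof cases
    case 1
    have "?f ` above \<inter> fst ` P = {}" using pic square_minus_shadow by blast
    then show ?thesis using region_contains[OF R connected_plane_frame[OF connected_above]] 1 w by blast
  next
    case 2
    have "?f ` below \<inter> fst ` P = {}" using pic square_minus_shadow by blast
    then show ?thesis using region_contains[OF R connected_plane_frame[OF connected_below]] 2 w by blast
  next
    case 3
    have "?f ` loop_interior \<inter> fst ` P = {}" using pic square_minus_shadow by blast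
    moreover have "frontier (?f ` loop_interior) \<subseteq> fst ` P"
    proof
      fix q assume "q \<in> frontier (?f ` loop_interior)"
      then obtain x y where q: "q = ?f (x, y)" "y \<le> 1 \<and> x + 2 \<le> 3 * y \<and> 2 - x \<le> 3 * y \<and>
           (y = 1 \<or> 3 * y = x + 2 \<or> 3 * y = 2 - x)"
        using frontier_loop[OF a] by blast
      then have "(x, y) \<in> square 7" "(x, y) \<in> shadow" by (auto simp: square_def shadow_def)
      then show "q \<in> fst ` P" using pic q(1) by blast
    qed
    ultimately have "R = ?f ` loop_interior"
      using 3 w by (intro region_eqI[OF R connected_plane_frame] convex_connected convex_loop_interior) auto
    then show ?thesis by blast
  qed
qed

text \<open>
  The frontier of the triangle is its boundary, which consists of the crossing and the open arc \<open>l\<close>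
  of the loop. A side contains no crossing, so it lies on this arc and is then equal to it. Hence
  there is at most one side.
\<close>

lemma loop_not_lune:
  assumes K: "carries P kink c u"
  shows "\<not> lune P (plane_frame (fst c) (fst u) ` loop_interior)"
proof -
  let ?f = "plane_frame (fst c) (fst u)"
  have a: "fst u \<noteq> 0" using K by (simp add: carries_def)
  define l where "l = (\<lambda>x::real. (x, (x + 2) / 3)) ` {0<..1} \<union> (\<lambda>x. (x, 1)) ` {-1..1} \<union>
    (\<lambda>x. (x, (2 - x) / 3)) ` {-1..<0}"
  have l_iff: "(x, y) \<in> l \<longleftrightarrow> 0 < x \<and> x \<le> 1 \<and> y = (x + 2) / 3 \<or> -1 \<le> x \<and> x \<le> 1 \<and> y = 1 \<or>
      -1 \<le> x \<and> x < 0 \<and> y = (2 - x) / 3" for x y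
    unfolding l_def by (auto simp: image_iff)
  have pieces: "connected ((\<lambda>x::real. (x, (x + 2) / 3)) ` {0<..1})" "connected ((\<lambda>x::real. (x, 1::real)) ` {-1..1})"
    "connected ((\<lambda>x::real. (x, (2 - x) / 3)) ` {-1..<0})"
    by (intro connected_continuous_image continuous_intros connected_Ioc connected_Icc connected_Ico; simp)+
  have "(1, 1) \<in> (\<lambda>x::real. (x, (x + 2) / 3)) ` {0<..1}" "(1, 1) \<in> (\<lambda>x::real. (x, 1::real)) ` {-1..1}"
    "(-1, 1) \<in> (\<lambda>x::real. (x, 1::real)) ` {-1..1}" "(-1, 1) \<in> (\<lambda>x::real. (x, (2 - x) / 3)) ` {-1..<0}"
    by (auto simp: image_iff)
  then have "connected l" unfolding l_def
    by (intro connected_Un pieces) blast+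
  have l: "l \<subseteq> square 7" "l \<subseteq> shadow" "(0, 2/3) \<notin> l"
    by (auto simp: l_iff square_def shadow_def)
  have "?f ` l \<inter> crossings P = {}"
  proof -
    have "?f w \<notin> crossings P" if "w \<in> l" for w
      using carries_kink_crossing[OF K, of "?f w"] a l that by auto
    then show ?thesis by blast
  qed
  moreover have "?f ` l \<subseteq> fst ` P" using carries_picture[OF K] l fst_kink by blast
  ultimately have sub: "?f ` l \<subseteq> fst ` P - crossings P" by blast
  have "sides P (?f ` loop_interior) \<subseteq> {?f ` l}"
  proof
    fix e assume "e \<in> sides P (?f ` loop_interior)"
    then have e: "e \<in> components (fst ` P - crossings P)" "e \<subseteq> frontier (?f ` loop_interior)"
      by (auto simp: sides_def edges_def)
    have "?f (0, 2/3) \<in> crossings P"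
      using carries_kink_crossing[OF K, of "?f (0, 2/3)"] a by (simp add: square_def)
    then have "?f (0, 2/3) \<notin> e" using e(1) in_components_subset by blast
    have "e \<subseteq> ?f ` l"
    proof
      fix q assume "q \<in> e"
      then obtain x y where q: "q = ?f (x, y)" "y \<le> 1 \<and> x + 2 \<le> 3 * y \<and> 2 - x \<le> 3 * y \<and>
           (y = 1 \<or> 3 * y = x + 2 \<or> 3 * y = 2 - x)"
        using e(2) frontier_loop[OF a, of "fst c"] by blast
      then have "(x, y) \<noteq> (0, 2/3)" using \<open>q \<in> e\<close> \<open>?f (0, 2/3) \<notin> e\<close> by metis
      then have "(x, y) \<in> l" using q(2) unfolding l_iff prod.inject by argo
      then show "q \<in> ?f ` l" using q(1) by (rule rev_image_eqI)
    qed
    moreover have "e \<noteq> {}" using e(1) in_components_nonempty by blast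
    ultimately have "e \<inter> ?f ` l \<noteq> {}" by blast
    then have "?f ` l \<subseteq> e"
      using components_maximal[OF e(1) connected_plane_frame[OF \<open>connected l\<close>] sub] by blast
    with \<open>e \<subseteq> ?f ` l\<close> show "e \<in> {?f ` l}" by blast
  qed
  then have "card (sides P (?f ` loop_interior)) \<le> card {?f ` l}" by (intro card_mono) auto
  then show ?thesis by (simp add: lune_def)
qed

section \<open>Rows of kinks\<close>

text \<open>
  The edge from the crossing of one kink to that of the next one, which is 12 units further on.
\<close>

definition bridge :: "(real \<times> real) set" where
  "bridge = (\<lambda>x. (x, max 0 (max ((2 - x) / 3) ((x - 10) / 3)))) ` {0<..<12}"

lemma connected_bridge: "connected bridge"
  unfolding bridge_def by (intro connected_continuous_image continuous_intros connected_Ioo) auto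

lemma bridge_iff:
  "(x, y) \<in> bridge \<longleftrightarrow> 0 < x \<and> x < 12 \<and>
     (x \<le> 2 \<and> 3 * y = 2 - x \<or> 2 \<le> x \<and> x \<le> 10 \<and> y = 0 \<or> 10 \<le> x \<and> 3 * y = x - 10)"
  unfolding bridge_def by (auto simp: image_iff max_def)

lemma shadow_right: "0 \<le> x \<Longrightarrow> x \<le> 6 \<Longrightarrow> \<bar>y\<bar> \<le> 2/3 \<Longrightarrow> (x, y) \<noteq> (0, 2/3) \<Longrightarrow>
    (x, y) \<in> shadow \<longleftrightarrow> (x, y) \<in> bridge"
  unfolding bridge_iff shadow_def by auto

lemma shadow_left: "6 \<le> x \<Longrightarrow> x \<le> 12 \<Longrightarrow> \<bar>y\<bar> \<le> 2/3 \<Longrightarrow> (x, y) \<noteq> (12, 2/3) \<Longrightarrow>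
    (x - 12, y) \<in> shadow \<longleftrightarrow> (x, y) \<in> bridge"
  unfolding bridge_iff shadow_def by auto

text \<open>
  The edges between the kinks separate the two sides of the strand, so both sides come
  vertically close to each of their points. The part before the middle is seen in the frame of the
  first kink and the rest in that of the second one.
\<close>

lemma bridge_vertical:
  assumes "(x, y) \<in> bridge"
  obtains d where "0 < d"
    "\<And>t. 0 < t \<Longrightarrow> t < d \<Longrightarrow> (x, y + t) \<in> above \<or> (x - 12, y + t) \<in> above"
    "\<And>t. 0 < t \<Longrightarrow> t < d \<Longrightarrow> (x, y - t) \<in> below \<or> (x - 12, y - t) \<in> below"
proof (cases "x \<le> 6")
  case True
  define d where "d = min 1 (2 * x / 3)"
  show ?thesis
    by (rule that[of d]) (use assms True in \<open>auto simp: d_def bridge_iff above_def below_def square_def\<close>)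
next
  case False
  define d where "d = min 1 (2 * (12 - x) / 3)"
  show ?thesis
    by (rule that[of d]) (use assms False in \<open>auto simp: d_def bridge_iff above_def below_def square_def\<close>)
qed

lemma plane_frame_vertical_closure:
  assumes "0 < d" "\<And>t. 0 < t \<Longrightarrow> t < d \<Longrightarrow> plane_frame c a (x, y + s * t) \<in> R"
  shows "plane_frame c a (x, y) \<in> closure R"
proof -
  define X where "X = (\<lambda>n. plane_frame c a (x, y + s * (d / real (n + 2))))"
  have "X n \<in> R" for n
    unfolding X_def using assms(1) by (intro assms(2)) (auto simp: field_simps intro: add_pos_nonneg)
  moreover have "(\<lambda>n. d / real (n + 2)) \<longlonglongrightarrow> 0"
    using LIMSEQ_ignore_initial_segment[OF lim_const_over_n[of d], of 2] by simp
  then have "(\<lambda>n. (x, y + s * (d / real (n + 2)))) \<longlonglongrightarrow> (x, y + s * 0)"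
    by (intro tendsto_intros)
  then have "(\<lambda>n. (x, y + s * (d / real (n + 2)))) \<longlonglongrightarrow> (x, y)" by simp
  then have "X \<longlonglongrightarrow> plane_frame c a (x, y)"
    unfolding X_def using continuous_on_plane_frame[of UNIV c a]
    by (intro isCont_tendsto_compose[where g = "plane_frame c a"]) (simp_all add: continuous_on_eq_continuous_at)
  ultimately show ?thesis unfolding closure_sequential by blast
qed

text \<open>
  Both frames have the same axes, hence a point of the second one is a point of the first one with
  its first coordinate increased by 12.
\<close>

locale adjacent_kinks =
  fixes P :: "space set" and c u c' :: space
  assumes left: "carries P kink c u" and right: "carries P kink c' u"
    and c': "c' = c + 12 *\<^sub>R u"
begin

abbreviation "f \<equiv> plane_frame (fst c) (fst u)"

lemma f': "plane_frame (fst c') (fst u) (x, y) = f (x + 12, y)"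
  using plane_frame_shift[of "fst c" 12 "fst u"] by (simp add: c')

lemma a: "fst u \<noteq> 0" using left by (simp add: carries_def)

lemma picture_left: "(x, y) \<in> square 7 \<Longrightarrow> f (x, y) \<in> fst ` P - crossings P \<longleftrightarrow> (x, y) \<in> shadow \<and> (x, y) \<noteq> (0, 2/3)"
  using carries_picture[OF left] carries_kink_crossing[OF left, of "f (x, y)"] a by (simp add: fst_kink)

lemma picture_right:
  assumes "(x - 12, y) \<in> square 7"
  shows "f (x, y) \<in> fst ` P - crossings P \<longleftrightarrow> (x - 12, y) \<in> shadow \<and> (x, y) \<noteq> (12, 2/3)"
proof -
  have e: "f (x, y) = plane_frame (fst c') (fst u) (x - 12, y)" using f'[of "x - 12" y] by simp
  show ?thesis
    unfolding e using carries_picture[OF right assms] assms a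
      carries_kink_crossing[OF right, of "plane_frame (fst c') (fst u) (x - 12, y)"]
    by (simp add: fst_kink)
qed

lemma picture_between:
  assumes "0 \<le> x" "x \<le> 12" "\<bar>y\<bar> \<le> 2/3"
  shows "f (x, y) \<in> fst ` P - crossings P \<longleftrightarrow> (x, y) \<in> bridge"
proof (cases "x \<le> 6")
  case True
  then have "(x, y) \<in> square 7" using assms by (auto simp: square_def)
  moreover have "(0, 2/3) \<notin> bridge" by (auto simp: bridge_iff)
  ultimately show ?thesis using picture_left shadow_right assms True by metis
next
  case False
  then have "(x - 12, y) \<in> square 7" "6 \<le> x" using assms by (auto simp: square_def)
  moreover have "(12, 2/3) \<notin> bridge" by (auto simp: bridge_iff)
  ultimately show ?thesis using picture_right shadow_left assms by metis
qed

text \<open>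
  The bridge is the part of the punctured picture in the open rectangle \<open>U\<close>, and already its part in
  the closed rectangle \<open>C\<close>: the picture leaves the rectangle only at the two crossings, which are the
  punctures. A component that leaves \<open>U\<close> would meet the frontier of \<open>U\<close>.
\<close>

lemma bridge_edge: "f ` bridge \<in> edges P"
proof -
  let ?X = "fst ` P - crossings P"
  define U where "U = {w::real \<times> real. 0 < fst w \<and> fst w < 12 \<and> \<bar>snd w\<bar> < 2/3}"
  define C where "C = {w::real \<times> real. 0 \<le> fst w \<and> fst w \<le> 12 \<and> \<bar>snd w\<bar> \<le> 2/3}"
  have bU: "bridge \<subseteq> U" by (auto simp: bridge_iff U_def)
  have UC: "U \<subseteq> C" by (auto simp: U_def C_def)
  have XC: "f w \<in> ?X \<longleftrightarrow> w \<in> bridge" if "w \<in> C" for w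
    using picture_between[of "fst w" "snd w"] that by (auto simp: C_def)
  have sub: "f ` bridge \<subseteq> ?X" using XC bU UC by blast
  have ne: "f (6, 0) \<in> f ` bridge" by (auto simp: bridge_iff)
  define e where "e = connected_component_set ?X (f (6, 0))"
  have "f (6, 0) \<in> ?X" using sub ne by (rule subsetD)
  then have e: "e \<in> components ?X" "f (6, 0) \<in> e"
    unfolding e_def by (rule componentsI)
      (simp only: mem_Collect_eq connected_component_refl_eq \<open>f (6, 0) \<in> ?X\<close>)
  have "f ` bridge \<subseteq> e"
    using components_maximal[OF e(1) connected_plane_frame[OF connected_bridge] sub] e(2) ne by blast
  moreover have "e \<subseteq> f ` U"
  proof (rule ccontr)
    assume "\<not> e \<subseteq> f ` U"
    moreover have "e \<inter> f ` U \<noteq> {}" using e(2) ne bU by blast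
    ultimately have "e \<inter> frontier (f ` U) \<noteq> {}"
      using connected_Int_frontier[of e "f ` U"] in_components_connected[OF e(1)] by blast
    moreover have "open U" unfolding U_def
      by (intro open_Collect_conj open_Collect_less continuous_intros)
    then have "interior (f ` U) = f ` U" by (intro interior_open open_plane_frame a)
    moreover have "closed C" unfolding C_def
      by (intro closed_Collect_conj closed_Collect_le continuous_intros)
    then have "closure (f ` U) \<subseteq> f ` C" using UC by (intro closure_minimal closed_plane_frame a) auto
    ultimately obtain w where w: "w \<in> C" "f w \<in> e" "f w \<notin> f ` U" unfolding frontier_def by blast
    then have "w \<in> bridge" using XC in_components_subset[OF e(1)] by blast
    then show False using w bU by blast
  qed
  then have "e \<subseteq> f ` bridge" using XC UC in_components_subset[OF e(1)] by blast
  ultimately have "e = f ` bridge" by blast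
  then show ?thesis using e(1) by (simp add: edges_def)
qed

lemma bridge_in_frontier:
  assumes R: "R \<in> regions P"
    and sides: "f ` above \<subseteq> R \<and> plane_frame (fst c') (fst u) ` above \<subseteq> R \<or>
      f ` below \<subseteq> R \<and> plane_frame (fst c') (fst u) ` below \<subseteq> R"
  shows "f ` bridge \<in> sides P R"
proof -
  have "f (x, y) \<in> frontier R" if xy: "(x, y) \<in> bridge" for x y
  proof (rule region_frontierI[OF R])
    show "f (x, y) \<in> fst ` P"
      using picture_between[of x y] xy by (auto simp: bridge_iff)
    obtain d where d: "0 < d"
      "\<And>t. 0 < t \<Longrightarrow> t < d \<Longrightarrow> (x, y + t) \<in> above \<or> (x - 12, y + t) \<in> above"
      "\<And>t. 0 < t \<Longrightarrow> t < d \<Longrightarrow> (x, y - t) \<in> below \<or> (x - 12, y - t) \<in> below"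
      using bridge_vertical[OF xy] by blast
    have r: "f (x, z) = plane_frame (fst c') (fst u) (x - 12, z)" for z using f'[of "x - 12" z] by simp
    from sides show "f (x, y) \<in> closure R"
    proof
      assume s: "f ` above \<subseteq> R \<and> plane_frame (fst c') (fst u) ` above \<subseteq> R"
      have "f (x, y + 1 * t) \<in> R" if "0 < t" "t < d" for t
        using d(2)[OF that] s r[of "y + t"] by auto
      then show ?thesis by (rule plane_frame_vertical_closure[OF d(1)])
    next
      assume s: "f ` below \<subseteq> R \<and> plane_frame (fst c') (fst u) ` below \<subseteq> R"
      have "f (x, y + (- 1) * t) \<in> R" if "0 < t" "t < d" for t
        using d(3)[OF that] s r[of "y - t"] by auto
      then show ?thesis by (rule plane_frame_vertical_closure[OF d(1)])
    qed
  qed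
  then have "f ` bridge \<subseteq> frontier R" by auto
  then show ?thesis using bridge_edge by (simp add: sides_def)
qed

text \<open>
  The two squares overlap, and in the overlap the sides of the strand agree.
\<close>

lemma same_region:
  assumes R: "R \<in> regions P"
  shows "f ` above \<subseteq> R \<longleftrightarrow> plane_frame (fst c') (fst u) ` above \<subseteq> R"
    and "f ` below \<subseteq> R \<longleftrightarrow> plane_frame (fst c') (fst u) ` below \<subseteq> R"
proof -
  have disj: "plane_frame (fst b) (fst u) ` S \<inter> fst ` P = {}" if "carries P kink b u" "S \<subseteq> square 7 - shadow" for b S
    using carries_picture[OF that(1)] that(2) fst_kink by blast
  have S: "above \<subseteq> square 7 - shadow" "below \<subseteq> square 7 - shadow" using square_minus_shadow by blast+
  have pt: "f (6, y) = plane_frame (fst c') (fst u) (-6, y)" for y using f'[of "-6" y] by simp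
  have "(6, 1) \<in> above" "(-6, 1) \<in> above" "(6, -1) \<in> below" "(-6, -1) \<in> below"
    by (auto simp: above_def below_def square_def)
  then have "f ` above \<inter> plane_frame (fst c') (fst u) ` above \<noteq> {}" "f ` below \<inter> plane_frame (fst c') (fst u) ` below \<noteq> {}"
    using pt by blast+
  then show "f ` above \<subseteq> R \<longleftrightarrow> plane_frame (fst c') (fst u) ` above \<subseteq> R"
    "f ` below \<subseteq> R \<longleftrightarrow> plane_frame (fst c') (fst u) ` below \<subseteq> R"
    using region_contains[OF R connected_plane_frame[OF connected_above] disj[OF left S(1)]]
      region_contains[OF R connected_plane_frame[OF connected_above] disj[OF right S(1)]]
      region_contains[OF R connected_plane_frame[OF connected_below] disj[OF left S(2)]]
      region_contains[OF R connected_plane_frame[OF connected_below] disj[OF right S(2)]]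
    by blast+
qed

end

text \<open>
  A region near the row is either the triangle in a kink, or it extends along one side of the strand
  from the first kink to the last. In the second case it has the three edges between the four
  crossings among its sides. Three kinks would yield only two such edges.
\<close>

lemma four_kinks_no_lune:
  assumes K: "\<And>k::nat. k < 4 \<Longrightarrow> carries P kink (p + (12 * real k) *\<^sub>R u) u"
    and k: "k < 4" and R: "R \<in> regions P"
    and meets: "R \<inter> plane_frame (fst (p + (12 * real k) *\<^sub>R u)) (fst u) ` square 7 \<noteq> {}"
  shows "\<not> lune P R"
proof (cases "R = plane_frame (fst (p + (12 * real k) *\<^sub>R u)) (fst u) ` loop_interior")
  case True
  then show ?thesis using loop_not_lune[OF K[OF k]] by simp
next
  case False
  define C where "C = (\<lambda>k::nat. p + (12 * real k) *\<^sub>R u)"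
  let ?f = "\<lambda>k. plane_frame (fst (C k)) (fst u)"
  have adj: "adjacent_kinks P (C k) u (C (Suc k))" if "k < 3" for k
    using K[of k] K[of "Suc k"] that by unfold_locales (auto simp: C_def algebra_simps)
  have a: "fst u \<noteq> 0" using K[of 0] by (simp add: carries_def)
  have start: "?f k ` above \<subseteq> R \<or> ?f k ` below \<subseteq> R"
    using region_near_kink[OF R K[OF k] meets] False unfolding C_def by blast
  have spread: "?f j ` above \<subseteq> R \<longleftrightarrow> ?f 0 ` above \<subseteq> R" "?f j ` below \<subseteq> R \<longleftrightarrow> ?f 0 ` below \<subseteq> R"
    if "j < 4" for j
    using that
  proof (induction j)
    case (Suc j)
    { case 1 then show ?case using adjacent_kinks.same_region(1)[OF adj R, of j] Suc by simp }
    { case 2 then show ?case using adjacent_kinks.same_region(2)[OF adj R, of j] Suc by simp }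
  qed simp_all
  have sides: "?f j ` bridge \<in> sides P R" if "j < 3" for j
  proof (rule adjacent_kinks.bridge_in_frontier[OF adj[OF that] R])
    show "?f j ` above \<subseteq> R \<and> ?f (Suc j) ` above \<subseteq> R \<or> ?f j ` below \<subseteq> R \<and> ?f (Suc j) ` below \<subseteq> R"
      using start spread[of j] spread[of "Suc j"] spread[OF k] that by auto
  qed
  have "inj_on (\<lambda>j. ?f j ` bridge) {..<3}"
  proof (rule inj_onI)
    fix i j :: nat assume "?f i ` bridge = ?f j ` bridge"
    then have "?f i (6, 0) \<in> ?f j ` bridge" by (auto simp: bridge_iff)
    moreover have "?f n (x, y) = plane_frame (fst p) (fst u) (x + 12 * real n, y)" for n x y
      using plane_frame_shift[of "fst p" "12 * real n" "fst u" x y] by (simp add: C_def)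
    ultimately obtain x y where "(x, y) \<in> bridge" "x + 12 * real j = 6 + 12 * real i"
      using a by auto
    then have "\<bar>real j - real i\<bar> < 1" unfolding bridge_iff by auto
    then show "i = j" by linarith
  qed
  then have 3: "card ((\<lambda>j. ?f j ` bridge) ` {..<3}) = 3" by (simp add: card_image)
  have "card (sides P R) \<noteq> 2"
  proof
    assume 2: "card (sides P R) = 2"
    then have "finite (sides P R)" by (metis card.infinite zero_neq_numeral)
    then have "card ((\<lambda>j. ?f j ` bridge) ` {..<3}) \<le> card (sides P R)"
      by (rule card_mono) (use sides in blast)
    then show False using 2 3 by simp
  qed
  then show ?thesis by (simp add: lune_def)
qed

section \<open>Generic points of the picture\<close>

text \<open>
  A simple closed curve is infinite, and the projection has finite fibres.
\<close>

lemma infinite_picture: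
  assumes "link_diagram P" shows "infinite (fst ` P)"
proof
  assume fin: "finite (fst ` P)"
  have "finite {p \<in> P. fst p = x}" for x
    using assms unfolding link_diagram_def by simp
  then have "finite (\<Union>x\<in>fst ` P. {p \<in> P. fst p = x})" using fin by (intro finite_UN_I)
  moreover have "P \<subseteq> (\<Union>x\<in>fst ` P. {p \<in> P. fst p = x})" by (rule subsetI) (simp, blast)
  ultimately have finP: "finite P" by (rule finite_subset[rotated])
  obtain g where g: "simple_path g" "path_image g \<subseteq> P"
  proof -
    have "disjoint_closed_curves P" using assms unfolding link_diagram_def polygonal_link_def by simp
    then obtain \<K> where K: "\<K> \<noteq> {}" "P = \<Union>\<K>"
      "\<forall>K\<in>\<K>. \<exists>g. simple_path g \<and> pathfinish g = pathstart g \<and> K = path_image g"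
      unfolding disjoint_closed_curves_def by (elim exE conjE) rule
    then obtain K where "K \<in> \<K>" by auto
    then show ?thesis using K that by (metis Union_upper)
  qed
  have "finite (path_image g)" using g(2) finP by (rule finite_subset)
  moreover have "connected (path_image g)" using g(1) by (simp add: connected_simple_path_image)
  ultimately have "path_image g = {} \<or> (\<exists>a. path_image g = {a})"
    using connected_finite_iff_sing[of "path_image g"] by simp
  moreover have "g 0 \<in> path_image g" "g (1/2) \<in> path_image g" by (auto simp: path_image_def)
  ultimately have "g 0 = g (1/2)" by auto
  then show False
    using bspec[OF bspec[OF conjunct2[OF g(1)[unfolded simple_path_def loop_free_def]], of 0], of "1/2"] by simp
qed

text \<open>
  Shortening the direction vector makes the frame so small that its square fits into the disc.
\<close>

lemma straight_frame:
  assumes e: "0 < e" and u: "fst u \<noteq> 0"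
    and P: "\<And>q. fst q \<in> ball (fst p) e \<Longrightarrow> q \<in> P \<longleftrightarrow> q \<in> range (\<lambda>t. p + t *\<^sub>R u)"
  obtains v where "carries P strand p v" "prism p v 7 \<subseteq> {q. fst q \<in> ball (fst p) e}"
proof -
  define s where "s = e / (15 * norm (fst u))"
  have s: "0 < s" using e u by (simp add: s_def)
  define v where "v = s *\<^sub>R u"
  have v: "fst v \<noteq> 0" using s u by (simp add: v_def)
  have nv: "15 * norm (fst v) = e" using u e by (simp add: v_def s_def)
  have near: "fst q \<in> ball (fst p) e" if "q \<in> prism p v 7" for q
  proof -
    define w where "w = plane_coord (fst p) (fst v) (fst q)"
    have w: "\<bar>fst w\<bar> < 7" "\<bar>snd w\<bar> < 7" "fst q = plane_frame (fst p) (fst v) w"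
      using that v by (simp_all add: w_def prism_def square_def)
    have "dist (fst q) (fst p) = norm (fst w *\<^sub>R fst v + snd w *\<^sub>R rot (fst v))"
      unfolding w(3) plane_frame_def dist_norm by (simp add: add.assoc)
    also have "\<dots> \<le> \<bar>fst w\<bar> * norm (fst v) + \<bar>snd w\<bar> * norm (fst v)"
      by (rule order_trans[OF norm_triangle_ineq]) simp
    also have "\<dots> \<le> 7 * norm (fst v) + 7 * norm (fst v)"
      using w by (intro add_mono mult_right_mono) auto
    also have "\<dots> < e" using nv e by simp
    finally show ?thesis by (simp add: dist_commute)
  qed
  have strand: "frame p v ` strand = range (\<lambda>t. p + t *\<^sub>R u)"
  proof -
    have fr: "frame p v ((t, 0), 0) = p + (t * s) *\<^sub>R u" for t
      by (simp add: frame_def plane_frame_def v_def prod_eq_iff)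
    have st: "strand = range (\<lambda>t. ((t, 0), 0))" by (auto simp: strand_def)
    have "frame p v ` strand = range (\<lambda>t. p + (t * s) *\<^sub>R u)" unfolding st image_image fr ..
    also have "\<dots> = (\<lambda>t. p + t *\<^sub>R u) ` range (\<lambda>t. t * s)" by (simp add: image_image)
    also have "range (\<lambda>t. t * s) = UNIV" using s by (intro surjI[of _ "\<lambda>t. t / s"]) simp
    finally show ?thesis .
  qed
  have "P \<inter> prism p v 7 = frame p v ` strand \<inter> prism p v 7"
    unfolding strand using P near by blast
  then have "carries P strand p v" using v by (simp add: carries_def)
  moreover have "prism p v 7 \<subseteq> {q. fst q \<in> ball (fst p) e}" using near by blast
  ultimately show ?thesis by (rule that)
qed

text \<open>
  The bound on \<open>r\<close> and \<open>s\<close> keeps the smaller square inside the larger one.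
\<close>

lemma carries_subframe:
  assumes P: "carries P strand p u" and s: "0 < s" "\<bar>r\<bar> + 7 * s \<le> 7"
  shows "carries P strand (p + r *\<^sub>R u) (s *\<^sub>R u)"
    and "prism (p + r *\<^sub>R u) (s *\<^sub>R u) 7 \<subseteq> prism p u 7"
proof -
  have u: "fst u \<noteq> 0" using P by (simp add: carries_def)
  have fr: "frame (p + r *\<^sub>R u) (s *\<^sub>R u) ((x, y), z) = frame p u ((r + s * x, s * y), z)" for x y z
    by (simp add: frame_def plane_frame_def rot_scaleR algebra_simps)
  have co: "coord (p + r *\<^sub>R u) (s *\<^sub>R u) q = (((fst (fst (coord p u q)) - r) / s, snd (fst (coord p u q)) / s), snd (coord p u q))" (is "_ = ?w")
    for q
  proof -
    have "frame (p + r *\<^sub>R u) (s *\<^sub>R u) ?w = frame p u ((fst (fst (coord p u q)), snd (fst (coord p u q))), snd (coord p u q))"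
      unfolding fr using s by simp
    also have "\<dots> = q" by (simp only: prod.collapse frame_coord[OF u])
    finally have "coord (p + r *\<^sub>R u) (s *\<^sub>R u) q = coord (p + r *\<^sub>R u) (s *\<^sub>R u) (frame (p + r *\<^sub>R u) (s *\<^sub>R u) ?w)" by simp
    also have "\<dots> = ?w" using u s by (intro coord_frame) simp
    finally show ?thesis .
  qed
  show sub: "prism (p + r *\<^sub>R u) (s *\<^sub>R u) 7 \<subseteq> prism p u 7"
  proof
    fix q assume "q \<in> prism (p + r *\<^sub>R u) (s *\<^sub>R u) 7"
    then have "\<bar>fst (fst (coord p u q)) - r\<bar> < 7 * s" "\<bar>snd (fst (coord p u q))\<bar> < 7 * s"
      unfolding prism_def square_def mem_Collect_eq co using s by (simp_all add: abs_divide divide_less_eq)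
    then show "q \<in> prism p u 7"
      unfolding prism_def square_def mem_Collect_eq using s by linarith
  qed
  have "q \<in> frame (p + r *\<^sub>R u) (s *\<^sub>R u) ` strand \<longleftrightarrow> q \<in> frame p u ` strand" for q
  proof -
    have "fst (s *\<^sub>R u) \<noteq> 0" using u s by simp
    then show ?thesis
      unfolding frame_image_iff[OF u] frame_image_iff[OF \<open>fst (s *\<^sub>R u) \<noteq> 0\<close>] co strand_def
      using s by (simp add: case_prod_unfold)
  qed
  then have "P \<inter> prism (p + r *\<^sub>R u) (s *\<^sub>R u) 7 = frame (p + r *\<^sub>R u) (s *\<^sub>R u) ` strand \<inter> prism (p + r *\<^sub>R u) (s *\<^sub>R u) 7"
    using P sub unfolding carries_def by blast
  then show "carries P strand (p + r *\<^sub>R u) (s *\<^sub>R u)"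
    using u s unfolding carries_def by simp
qed

text \<open>
  The exceptional set \<open>V\<close> consists of the crossings, the projected end points of the segments, and
  the points in which two projected segments meet without overlapping. At any other point of the
  picture all segments overlap along one line; the absence of crossings nearby lets a single segment
  of space account for the whole link over a small disc. The list of segments is arbitrary and may be
  redundant, which is why mutual intersections have to be removed explicitly.

  The set \<open>M\<close> consists of those midpoints between two exceptional points on a segment that are
  generic. A generic point
  on this segment is joined to one of them by the open interval between the nearest exceptional
  points on its two sides.
\<close>

lemma polygon_generic_points:
  assumes P: "link_diagram P"
  shows "\<exists>V. finite V \<and>
     (\<forall>x\<in>fst ` P - V. \<forall>e>0. \<exists>p u. fst p = x \<and> carries P strand p u \<and> prism p u 7 \<subseteq> {q. fst q \<in> ball x e}) \<and>
     (\<exists>M. finite M \<and> M \<subseteq> fst ` P - V \<and>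
       (\<forall>x\<in>fst ` P - V. \<exists>m\<in>M. \<exists>E. connected E \<and> E \<subseteq> fst ` P - V \<and> x \<in> E \<and> m \<in> E))"
proof -
  obtain S where S: "finite S" "P = (\<Union>(a, b)\<in>S. closed_segment a b)"
    using P unfolding link_diagram_def polygonal_link_def by (elim conjE exE) rule
  define seg where "seg = (\<lambda>s::space \<times> space. closed_segment (fst (fst s)) (fst (snd s)))"
  have seg: "fst ` closed_segment a b = seg (a, b)" for a b
    unfolding seg_def using closed_segment_linear_image[OF linear_fst, symmetric] by simp
  have PS: "q \<in> P \<longleftrightarrow> (\<exists>s\<in>S. q \<in> closed_segment (fst s) (snd s))" for q
    unfolding S(2) by (simp add: case_prod_unfold)
  define W where "W = {x. \<exists>s\<in>S. \<exists>t\<in>S. seg s \<inter> seg t = {x}}"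
  define V where "V = crossings P \<union> (\<Union>s\<in>S. {fst (fst s), fst (snd s)}) \<union> W"
  have "W \<subseteq> (\<lambda>(s, t). the_elem (seg s \<inter> seg t)) ` (S \<times> S)"
  proof
    fix x assume "x \<in> W"
    then obtain s t where st: "s \<in> S" "t \<in> S" "seg s \<inter> seg t = {x}" unfolding W_def mem_Collect_eq by (elim bexE)
    then have "x = the_elem (seg s \<inter> seg t)" by simp
    then show "x \<in> (\<lambda>(s, t). the_elem (seg s \<inter> seg t)) ` (S \<times> S)"
      using st by (intro image_eqI[of _ _ "(s, t)"]) auto
  qed
  then have "finite W" using S(1) finite_subset by (metis finite_SigmaI finite_imageI)
  moreover have fin_cr: "finite (crossings P)" using P by (simp add: link_diagram_def)
  ultimately have finV: "finite V" unfolding V_def using S(1) by simp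

  have straight: "\<exists>p u. fst p = x \<and> carries P strand p u \<and> prism p u 7 \<subseteq> {q. fst q \<in> ball x e0}"
    if x: "x \<in> fst ` P - V" and e0: "0 < e0" for x e0
  proof -
    obtain p where p: "p \<in> P" "fst p = x" using x by blast
    obtain s where s: "s \<in> S" "p \<in> closed_segment (fst s) (snd s)" using p(1) PS by metis
    define a b where "a = fst s" and "b = snd s"
    have xs: "x \<in> seg s" using s(2) p(2) seg[of "fst s" "snd s"] by (metis imageI prod.collapse)
    have xV: "x \<notin> crossings P" "x \<noteq> fst a" "x \<noteq> fst b" "x \<notin> W"
      using x s(1) unfolding V_def a_def b_def by auto
    define u where "u = b - a"
    have u: "fst u \<noteq> 0"
    proof
      assume "fst u = 0"
      then have "fst a = fst b" by (simp add: u_def)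
      then show False using xs xV(2) by (simp add: seg_def a_def b_def)
    qed
    obtain \<sigma> where \<sigma>: "0 \<le> \<sigma>" "\<sigma> \<le> 1" "p = (1 - \<sigma>) *\<^sub>R a + \<sigma> *\<^sub>R b"
      using s(2) unfolding a_def b_def in_segment by auto
    have pa: "p = a + \<sigma> *\<^sub>R u" unfolding \<sigma>(3) u_def by (simp add: algebra_simps)
    have \<sigma>01: "0 < \<sigma>" "\<sigma> < 1"
      using \<sigma> xV(2,3) p(2) by (auto simp: order_less_le)
    \<comment> \<open>The crossings and the segments that miss \<open>x\<close> stay at a distance.\<close>
    define C where "C = crossings P \<union> (\<Union>t\<in>{t \<in> S. x \<notin> seg t}. seg t)"
    have "closed C"
      unfolding C_def seg_def using S(1) fin_cr by (intro closed_Un closed_UN finite_imp_closed) auto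
    moreover have "x \<notin> C" using xV(1) unfolding C_def by auto
    ultimately obtain e1 where e1: "0 < e1" "ball x e1 \<inter> C = {}"
      by (metis (no_types) ComplI disjoint_eq_subset_Compl open_Compl openE)
    define e where "e = min (min e0 e1) (min \<sigma> (1 - \<sigma>) * norm (fst u))"
    have e: "0 < e" "e \<le> e0" "e \<le> e1" "e \<le> \<sigma> * norm (fst u)" "e \<le> (1 - \<sigma>) * norm (fst u)"
      using e0 e1 \<sigma>01 u by (auto simp: e_def min_mult_distrib_right)
    have on_segment: "p + t *\<^sub>R u \<in> closed_segment a b" if "\<bar>t\<bar> * norm (fst u) < e" for t
    proof -
      have "\<bar>t\<bar> * norm (fst u) < \<sigma> * norm (fst u)" "\<bar>t\<bar> * norm (fst u) < (1 - \<sigma>) * norm (fst u)"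
        using that e by linarith+
      then have "\<bar>t\<bar> < \<sigma>" "\<bar>t\<bar> < 1 - \<sigma>" using u by auto
      then show ?thesis unfolding pa in_segment
        by (intro exI[of _ "\<sigma> + t"]) (auto simp: u_def algebra_simps)
    qed
    have dist_t: "dist x (x + t *\<^sub>R fst u) = \<bar>t\<bar> * norm (fst u)" for t
      by (simp add: dist_norm)
    have "q \<in> P \<longleftrightarrow> q \<in> range (\<lambda>t. p + t *\<^sub>R u)" if q: "fst q \<in> ball (fst p) e" for q
    proof
      assume "q \<in> range (\<lambda>t. p + t *\<^sub>R u)"
      then obtain t where t: "q = p + t *\<^sub>R u" by (rule rangeE)
      then have "\<bar>t\<bar> * norm (fst u) < e" using q dist_t[of t] p(2) by simp
      then show "q \<in> P" unfolding PS t using on_segment s(1) a_def b_def by metis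
    next
      assume "q \<in> P"
      then obtain t where t: "t \<in> S" "q \<in> closed_segment (fst t) (snd t)" using PS by metis
      have qt: "fst q \<in> seg t" using t(2) seg[of "fst t" "snd t"] by (metis imageI prod.collapse)
      have qx: "dist x (fst q) < e" using q p(2) by simp
      then have "fst q \<notin> C" using e1(2) e(3) by (meson IntI disjoint_iff mem_ball order_less_le_trans)
      then have q_cr: "fst q \<notin> crossings P" and xt: "x \<in> seg t" using t(1) qt unfolding C_def by blast+
      \<comment> \<open>The segment through \<open>q\<close> runs along the segment through \<open>p\<close>.\<close>
      have "seg s \<inter> seg t \<noteq> {x}" using xV(4) s(1) t(1) unfolding W_def mem_Collect_eq by metis
      then obtain y where y: "y \<in> seg s" "y \<in> seg t" "y \<noteq> x" using xs xt by blast
      have line: "\<exists>k. z = x + k *\<^sub>R fst u" if z: "z \<in> seg s" for z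
      proof -
        obtain \<tau> where "z = (1 - \<tau>) *\<^sub>R fst a + \<tau> *\<^sub>R fst b"
          using z unfolding seg_def in_segment a_def b_def by (elim exE conjE)
        then have "z = x + (\<tau> - \<sigma>) *\<^sub>R fst u"
          unfolding p(2)[symmetric] pa by (simp add: u_def algebra_simps)
        then show ?thesis by (rule exI)
      qed
      obtain k where k: "y = x + k *\<^sub>R fst u" using line[OF y(1)] by (rule exE)
      have "k \<noteq> 0" using k y(3) by auto
      have "collinear (seg t)" unfolding seg_def by (rule collinear_closed_segment)
      moreover have "{y, fst q, x} \<subseteq> seg t" using xt y(2) qt by blast
      ultimately have "collinear {y, fst q, x}" by (rule collinear_subset)
      then obtain j where "fst q = j *\<^sub>R y + (1 - j) *\<^sub>R x"
        unfolding collinear_3_expand using y(3) by blast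
      then have j: "fst q = x + j *\<^sub>R (y - x)" by (simp add: algebra_simps)
      have "fst q = x + (j * k) *\<^sub>R fst u" unfolding j k by simp
      moreover from this have "\<bar>j * k\<bar> * norm (fst u) < e" using qx dist_t[of "j * k"] by simp
      then have "p + (j * k) *\<^sub>R u \<in> P" unfolding PS using on_segment s(1) a_def b_def by metis
      ultimately have "q = p + (j * k) *\<^sub>R u"
        using q_cr \<open>q \<in> P\<close> p(2) unfolding crossings_def mem_Collect_eq by (metis fst_add fst_scaleR)
      then show "q \<in> range (\<lambda>t. p + t *\<^sub>R u)" by (rule range_eqI)
    qed
    then obtain v where "carries P strand p v" "prism p v 7 \<subseteq> {q. fst q \<in> ball (fst p) e}"
      using straight_frame[OF e(1) u, of p P] by metis
    moreover have "ball x e \<subseteq> ball x e0" using e(2) by (rule subset_ball)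
    ultimately show ?thesis using p(2) by blast
  qed

  define pt where "pt = (\<lambda>(s::space \<times> space) (t::real). (1 - t) *\<^sub>R fst (fst s) + t *\<^sub>R fst (snd s))"
  have seg_pt: "seg s = pt s ` {0..1}" for s
    unfolding seg_def pt_def closed_segment_image_interval ..
  define T where "T = (\<lambda>s. {t \<in> {0..1}. pt s t \<in> V})"
  define S' where "S' = {s \<in> S. fst (fst s) \<noteq> fst (snd s)}"
  have inj: "inj (pt s)" if "s \<in> S'" for s
  proof
    fix t t' assume "pt s t = pt s t'"
    then have "(t - t') *\<^sub>R (fst (snd s) - fst (fst s)) = 0" by (simp add: pt_def algebra_simps)
    then show "t = t'" using that by (auto simp: S'_def)
  qed
  have finT: "finite (T s)" if "s \<in> S'" for s
    using finite_vimageI[OF finV inj[OF that]] unfolding T_def by (rule finite_subset[rotated]) auto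
  define M where "M = (\<Union>s\<in>S'. (\<lambda>(t, t'). pt s ((t + t') / 2)) ` (T s \<times> T s)) \<inter> (fst ` P - V)"
  have "finite M" unfolding M_def S'_def using S(1) finT by (intro finite_Int disjI1 finite_UN_I finite_imageI finite_SigmaI) (auto simp: S'_def)
  moreover have "\<exists>m\<in>M. \<exists>E. connected E \<and> E \<subseteq> fst ` P - V \<and> x \<in> E \<and> m \<in> E" if x: "x \<in> fst ` P - V" for x
  proof -
    obtain p where p: "p \<in> P" "fst p = x" using x by blast
    obtain s where s: "s \<in> S" "p \<in> closed_segment (fst s) (snd s)" using p(1) PS by metis
    have xs: "x \<in> seg s" using s(2) p(2) seg[of "fst s" "snd s"] by (metis imageI prod.collapse)
    have ends: "fst (fst s) \<in> V" "fst (snd s) \<in> V" using s(1) unfolding V_def by auto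
    have "s \<in> S'" using s(1) ends xs x unfolding S'_def seg_def by auto
    obtain \<sigma> where \<sigma>: "0 \<le> \<sigma>" "\<sigma> \<le> 1" "x = pt s \<sigma>" using xs unfolding seg_pt by auto
    have \<sigma>T: "\<sigma> \<notin> T s" using x \<sigma> by (simp add: T_def)
    have "0 \<in> T s" "1 \<in> T s" using ends by (simp_all add: T_def pt_def)
    define l r where "l = Max {t \<in> T s. t \<le> \<sigma>}" and "r = Min {t \<in> T s. \<sigma> \<le> t}"
    have L: "finite {t \<in> T s. t \<le> \<sigma>}" "{t \<in> T s. t \<le> \<sigma>} \<noteq> {}" and R: "finite {t \<in> T s. \<sigma> \<le> t}" "{t \<in> T s. \<sigma> \<le> t} \<noteq> {}"
      using finT[OF \<open>s \<in> S'\<close>] \<open>0 \<in> T s\<close> \<open>1 \<in> T s\<close> \<sigma> by auto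
    have l: "l \<in> T s" "l \<le> \<sigma>" using Max_in[OF L] unfolding l_def by auto
    have r: "r \<in> T s" "\<sigma> \<le> r" using Min_in[OF R] unfolding r_def by auto
    have lr: "l < \<sigma>" "\<sigma> < r" using l r \<sigma>T by (auto simp: order_less_le)
    have gap: "t \<notin> T s" if "l < t" "t < r" for t
    proof
      assume "t \<in> T s"
      show False
      proof (cases "t \<le> \<sigma>")
        case True
        then have "t \<le> l" unfolding l_def using L \<open>t \<in> T s\<close> by (intro Max_ge) auto
        then show False using that by simp
      next
        case False
        then have "r \<le> t" unfolding r_def using R \<open>t \<in> T s\<close> by (intro Min_le) auto
        then show False using that by simp
      qed
    qed
    define E where "E = pt s ` {l<..<r}"
    have lr01: "0 \<le> l" "r \<le> 1" using l r by (auto simp: T_def)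
    have "connected E" unfolding E_def pt_def by (intro connected_continuous_image continuous_intros connected_Ioo)
    moreover have "E \<subseteq> fst ` P - V"
    proof
      fix z assume "z \<in> E"
      then obtain t where t: "l < t" "t < r" "z = pt s t" unfolding E_def by auto
      then have "t \<in> {0..1}" using lr01 by simp
      then have "z \<notin> V" using gap[OF t(1,2)] t(3) by (simp add: T_def)
      moreover have "z \<in> seg s" unfolding seg_pt t(3) using \<open>t \<in> {0..1}\<close> by (rule imageI)
      then have "z \<in> fst ` closed_segment (fst s) (snd s)" unfolding seg by simp
      then obtain q where q: "z = fst q" "q \<in> closed_segment (fst s) (snd s)" by (rule imageE)
      have "q \<in> P" unfolding PS using q(2) s(1) by (rule bexI)
      then have "z \<in> fst ` P" unfolding q(1) by (rule imageI)
      ultimately show "z \<in> fst ` P - V" by blast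
    qed
    moreover have "x \<in> E" unfolding E_def \<sigma>(3) using lr by (intro imageI) simp
    moreover have mid: "pt s ((l + r) / 2) \<in> E" unfolding E_def using lr by (intro imageI) simp
    moreover have "pt s ((l + r) / 2) \<in> M"
    proof -
      have "pt s ((l + r) / 2) \<in> (\<lambda>(t, t'). pt s ((t + t') / 2)) ` (T s \<times> T s)"
        using l(1) r(1) by (intro image_eqI[of _ _ "(l, r)"]) auto
      then show ?thesis unfolding M_def using \<open>s \<in> S'\<close> mid \<open>E \<subseteq> fst ` P - V\<close> by blast
    qed
    ultimately show ?thesis by blast
  qed
  moreover have "M \<subseteq> fst ` P - V" unfolding M_def by blast
  ultimately have gens: "\<exists>M. finite M \<and> M \<subseteq> fst ` P - V \<and>
       (\<forall>x\<in>fst ` P - V. \<exists>m\<in>M. \<exists>E. connected E \<and> E \<subseteq> fst ` P - V \<and> x \<in> E \<and> m \<in> E)"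
    by (intro exI[of _ M] conjI ballI)
  have "\<forall>x\<in>fst ` P - V. \<forall>e>0. \<exists>p u. fst p = x \<and> carries P strand p u \<and> prism p u 7 \<subseteq> {q. fst q \<in> ball x e}"
    using straight by (intro ballI allI impI)
  from conjI[OF finV conjI[OF this gens]] show ?thesis by (rule exI[where x = V])
qed

section \<open>Lune-free diagrams\<close>

text \<open>
  The two sides of the strand in the square are convex, and a region that meets one of them contains
  it, together with the whole strand in its closure.
\<close>

lemma strand_in_frontier:
  assumes P: "carries P strand c u" and R: "R \<in> regions P"
    and meets: "R \<inter> plane_frame (fst c) (fst u) ` square 7 \<noteq> {}"
  shows "fst ` P \<inter> plane_frame (fst c) (fst u) ` square 7 \<subseteq> frontier R"
proof -
  let ?f = "plane_frame (fst c) (fst u)"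
  have pic: "?f w \<in> fst ` P \<longleftrightarrow> snd w = 0" if "w \<in> square 7" for w
    using carries_picture[OF P that] by (simp add: fst_strand)
  define H where "H = (\<lambda>s::real. square 7 \<inter> {w. 0 * fst w + s * snd w < 0})"
  have H: "connected (?f ` H s)" for s
    unfolding H_def by (intro connected_plane_frame convex_connected convex_Int convex_square convex_half_plane)
  have disj: "?f ` H s \<inter> fst ` P = {}" for s
  proof -
    have "?f w \<notin> fst ` P" if "w \<in> H s" for w
      using pic[of w] that unfolding H_def by auto
    then show ?thesis by blast
  qed
  obtain w where w: "w \<in> square 7" "?f w \<in> R" using meets by blast
  have "?f w \<notin> fst ` P" using R w(2) in_components_subset unfolding regions_def by blast
  then have "snd w \<noteq> 0" using pic[OF w(1)] by simp
  then obtain s where s: "s = 1 \<or> s = -1" "w \<in> H s"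
    using w(1) unfolding H_def by (cases "snd w < 0") force+
  then have "?f ` H s \<subseteq> R" using region_contains[OF R H disj] w(2) by blast
  have fr: "?f v \<in> frontier R" if v: "v \<in> square 7" "?f v \<in> fst ` P" for v
  proof (rule region_frontierI[OF R _ v(2)])
    obtain x y where xy: "v = (x, y)" by (metis surj_pair)
    then have "y = 0" using pic[OF v(1)] v(2) by simp
    have "?f (x, y + (- s) * t) \<in> R" if "0 < t" "t < 7" for t
    proof -
      have "(x, y + (- s) * t) \<in> H s"
        using s(1) v(1) that unfolding H_def square_def xy \<open>y = 0\<close> by auto
      then show ?thesis using \<open>?f ` H s \<subseteq> R\<close> by blast
    qed
    moreover have "0 < (7::real)" by simp
    ultimately show "?f v \<in> closure R" unfolding xy by (intro plane_frame_vertical_closure) blast+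
  qed
  show ?thesis
  proof (intro subsetI, elim IntE imageE)
    fix y q v assume "y = fst q" "q \<in> P" "y = ?f v" "v \<in> square 7"
    then show "y \<in> frontier R" using fr[of v] by (metis imageI)
  qed
qed

text \<open>
  Removing finitely many points does not disconnect the plane.
\<close>

lemma finite_frontier_plane:
  fixes R :: "plane set"
  assumes "open R" "R \<noteq> {}" "finite (frontier R)" shows "R = - frontier R"
proof -
  have "connected (UNIV - frontier R)"
    by (rule connected_open_diff_countable) (use assms in \<open>auto simp: countable_finite\<close>)
  then have "connected (- frontier R)" by (simp add: Compl_eq_Diff_UNIV)
  moreover have sub: "R \<subseteq> - frontier R" using assms(1) by (auto simp: frontier_def interior_open)
  ultimately have "- frontier R - R = {}"
    using connected_Int_frontier[of "- frontier R" R] assms(2) by blast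
  then show ?thesis using sub by blast
qed

lemma closed_picture:
  assumes "link_diagram P" shows "closed (fst ` P)"
proof -
  obtain S where S: "finite S" "P = (\<Union>(a, b)\<in>S. closed_segment a b)"
    using assms unfolding link_diagram_def polygonal_link_def by (elim conjE exE) rule
  have "compact P" unfolding S(2) using S(1) by (intro compact_UN) (auto simp: case_prod_unfold)
  then show ?thesis
    by (intro compact_imp_closed compact_continuous_image continuous_on_fst continuous_on_id)
qed

lemma open_region:
  assumes "link_diagram P" "R \<in> regions P" shows "open R"
  using open_components[of "- fst ` P" R] closed_picture[OF assms(1)] assms(2) unfolding regions_def by blast

lemma frontier_region:
  assumes "link_diagram P" "R \<in> regions P" shows "frontier R \<subseteq> fst ` P"
proof -
  have "frontier R \<subseteq> frontier (- fst ` P)"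
    using assms(2) unfolding regions_def by (rule frontier_of_components_subset)
  also have "\<dots> \<subseteq> fst ` P"
    using closed_picture[OF assms(1)] by (simp add: frontier_complement frontier_subset_closed)
  finally show ?thesis .
qed

text \<open>
  The intersection of \<open>E\<close> and \<open>F\<close> is closed in \<open>E\<close> by assumption and open in \<open>E\<close> by the local
  condition.
\<close>

lemma connected_subset_locally:
  fixes E F :: "'a::topological_space set"
  assumes "connected E" "closed F" "x \<in> E" "x \<in> F"
    and local: "\<And>y. y \<in> E \<Longrightarrow> y \<in> F \<Longrightarrow> \<exists>U. open U \<and> y \<in> U \<and> U \<inter> E \<subseteq> F"
  shows "E \<subseteq> F"
proof -
  define B where "B = \<Union>{U. open U \<and> U \<inter> E \<subseteq> F}"
  have "open B" unfolding B_def by (rule open_Union) simp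
  have inB: "y \<in> B" if "y \<in> E" "y \<in> F" for y
    using local[OF that] unfolding B_def by blast
  have "B \<inter> E \<subseteq> F" unfolding B_def by blast
  then have "- F \<inter> B \<inter> E = {}" by blast
  moreover have "E \<subseteq> - F \<union> B" using inB by blast
  ultimately have "- F \<inter> E = {} \<or> B \<inter> E = {}"
    using connectedD[OF assms(1) _ \<open>open B\<close>, of "- F"] assms(2) by (simp add: open_Compl)
  then show ?thesis using inB[OF assms(3,4)] assms(3) by blast
qed

text \<open>
  A row of four kinks is placed at each point of the finite set \<open>M\<close> of \<open>polygon_generic_points\<close>. By
  \<open>four_kinks_no_lune\<close> it suffices that every region meets one of the squares around the kinks.
  Suppose that a region avoids them all. Outside of the squares the picture is unchanged. The
  frontier of the region cannot consist of exceptional points alone, since the region would then be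
  the complement of a finite set. So it contains a generic point. Along the curve \<open>E\<close> of generic
  points from there to a point \<open>m\<close> of \<open>M\<close> the frontier can be followed by \<open>strand_in_frontier\<close>, as it
  stays away from the kinks. It therefore contains \<open>m\<close>, which lies in a square.
\<close>

lemma link_diagram_lune_free:
  assumes P: "link_diagram P"
  shows "\<exists>Q. link_diagram Q \<and> ambient_isotopic P Q \<and> lune_free Q"
proof -
  obtain V where V: "finite V \<and>
     (\<forall>x\<in>fst ` P - V. \<forall>e>0. \<exists>p u. fst p = x \<and> carries P strand p u \<and> prism p u 7 \<subseteq> {q. fst q \<in> ball x e}) \<and>
     (\<exists>M. finite M \<and> M \<subseteq> fst ` P - V \<and>
       (\<forall>x\<in>fst ` P - V. \<exists>m\<in>M. \<exists>E. connected E \<and> E \<subseteq> fst ` P - V \<and> x \<in> E \<and> m \<in> E))"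
    using polygon_generic_points[OF P] by (rule exE)
  note finV = V[THEN conjunct1] and straight = V[THEN conjunct2, THEN conjunct1]
  obtain M where M: "finite M" "M \<subseteq> fst ` P - V"
    "\<forall>x\<in>fst ` P - V. \<exists>m\<in>M. \<exists>E. connected E \<and> E \<subseteq> fst ` P - V \<and> x \<in> E \<and> m \<in> E"
    using V[THEN conjunct2, THEN conjunct2] by (elim exE conjE)
  have "fst ` P - V \<noteq> {}" using infinite_picture[OF P] finV by (metis finite.emptyI finite_Diff2)
  then have "M \<noteq> {}" using M(3) by blast
  \<comment> \<open>Discs of radius \<open>d\<close> around the points of \<open>M\<close> are disjoint; the element 1 serves the case of a single point.\<close>
  define d where "d = Min (insert 1 ((\<lambda>(m, m'). dist m m') ` {z \<in> M \<times> M. fst z \<noteq> snd z})) / 2"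
  have finD: "finite ((\<lambda>(m, m'). dist m m') ` {z \<in> M \<times> M. fst z \<noteq> snd z})" using M(1) by simp
  have d: "0 < d" unfolding d_def using finD by (auto simp: case_prod_unfold)
  have d2: "2 * d \<le> dist m m'" if "m \<in> M" "m' \<in> M" "m \<noteq> m'" for m m'
  proof -
    have "dist m m' \<in> (\<lambda>(m, m'). dist m m') ` {z \<in> M \<times> M. fst z \<noteq> snd z}"
      using that by (intro image_eqI[of _ _ "(m, m')"]) auto
    then show ?thesis unfolding d_def using finD by (simp add: Min_le)
  qed
  have "\<forall>m\<in>M. \<exists>p u. fst p = m \<and> carries P strand p u \<and> prism p u 7 \<subseteq> {q. fst q \<in> ball m d}"
    using straight d M(2) by blast
  then obtain p u where pu: "\<And>m. m \<in> M \<Longrightarrow> fst (p m) = m" "\<And>m. m \<in> M \<Longrightarrow> carries P strand (p m) (u m)"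
    "\<And>m. m \<in> M \<Longrightarrow> prism (p m) (u m) 7 \<subseteq> {q. fst q \<in> ball m d}"
    by metis
  \<comment> \<open>The last kink of a row reaches to \<open>(3 * 12 + 7) / 10\<close> in the frame at \<open>m\<close>, hence the scale \<open>1/10\<close>.\<close>
  define v where "v = (\<lambda>m. (1/10) *\<^sub>R u m)"
  define c where "c = (\<lambda>m k. p m + (12 * real k) *\<^sub>R v m)"
  have c_eq: "c m k = p m + (12 * real k / 10) *\<^sub>R u m" for m k by (simp add: c_def v_def)
  have v_nz: "fst (v m) \<noteq> 0" if "m \<in> M" for m
    using pu(2)[OF that] by (simp add: carries_def v_def)
  have cS: "carries P strand (c m k) (v m)" and cd: "prism (c m k) (v m) 7 \<subseteq> {q. fst q \<in> ball m d}"
    if "m \<in> M" "k < 4" for m and k :: nat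
  proof -
    have "\<bar>12 * real k / 10\<bar> + 7 * (1/10) \<le> 7" using that(2) by simp
    then show "carries P strand (c m k) (v m)" "prism (c m k) (v m) 7 \<subseteq> {q. fst q \<in> ball m d}"
      using carries_subframe[OF pu(2)[OF that(1)], of "1/10" "12 * real k / 10"] pu(3)[OF that(1)]
      unfolding c_eq v_def by auto
  qed
  define G where "G = (\<lambda>(m, k). (c m k, v m)) ` (M \<times> {..<4::nat})"
  have G_iff: "(b, w) \<in> G \<longleftrightarrow> (\<exists>m\<in>M. \<exists>k<4. b = c m k \<and> w = v m)" for b w
    unfolding G_def by auto
  have UN_G: "\<exists>m\<in>M. \<exists>k<4. q \<in> prism (c m k) (v m) 3" if "q \<in> (\<Union>(c, u)\<in>G. prism c u 3)" for q
    using that unfolding G_def by auto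
  \<comment> \<open>Within a row, kinks are 12 units apart, so that a small and a large prism, with half widths 3 and 7, are disjoint.\<close>
  have coord_c: "coord (c m k) (v m) q = coord (c m 0) (v m) q - ((12 * real k, 0), 0)" if "m \<in> M" for m k q
  proof -
    have nz: "fst (v m) \<noteq> 0" using v_nz that .
    have "frame (c m k) (v m) (coord (c m 0) (v m) q - ((12 * real k, 0), 0)) = frame (c m 0) (v m) (coord (c m 0) (v m) q)"
      by (simp add: frame_def plane_frame_def c_def prod_eq_iff algebra_simps)
    also have "\<dots> = q" by (rule frame_coord[OF nz])
    finally show ?thesis using coord_frame[OF nz] by metis
  qed
  have "\<exists>Q. link_diagram Q \<and> ambient_isotopic P Q \<and>
    Q - (\<Union>(c, u)\<in>G. prism c u 3) = P - (\<Union>(c, u)\<in>G. prism c u 3) \<and>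
    (\<forall>(c, u)\<in>G. carries Q kink c u)"
  proof (rule insert_kinks[OF _ P])
    show "finite G" unfolding G_def using M(1) by simp
    show "carries P strand b w" if "(b, w) \<in> G" for b w using that cS unfolding G_iff by blast
    fix b w b' w' assume bw: "(b, w) \<in> G" "(b', w') \<in> G" "(b, w) \<noteq> (b', w')"
    obtain m k m' k' where mk: "m \<in> M" "k < 4" "b = c m k" "w = v m" "m' \<in> M" "k' < 4" "b' = c m' k'" "w' = v m'"
      using bw(1,2) unfolding G_iff by blast
    have 37: "prism b w 3 \<subseteq> prism b w 7" by (auto simp: prism_def square_def)
    show "prism b w 3 \<inter> prism b' w' 7 = {}"
    proof (cases "m = m'")
      case False
      have "ball m d \<inter> ball m' d = {}"
        using d2[OF mk(1,5) False] by (intro disjoint_ballI) simp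
      then show ?thesis using 37 cd[OF mk(1,2)] cd[OF mk(5,6)] mk by blast
    next
      case True
      then have "k \<noteq> k'" using bw(3) mk by auto
      then have kk: "real k \<le> real k' - 1 \<or> real k' \<le> real k - 1" by linarith
      have "\<not> (q \<in> prism b w 3 \<and> q \<in> prism b' w' 7)" for q
        unfolding mk True[symmetric] prism_def square_def mem_Collect_eq coord_c[OF mk(1), of k] coord_c[OF mk(1), of k']
        using kk by auto
      then show ?thesis by blast
    qed
  qed
  then obtain Q where Q: "link_diagram Q" "ambient_isotopic P Q"
    "Q - (\<Union>(c, u)\<in>G. prism c u 3) = P - (\<Union>(c, u)\<in>G. prism c u 3)"
    "\<forall>(c, u)\<in>G. carries Q kink c u"
    by (elim exE conjE)
  have QK: "carries Q kink (c m k) (v m)" if "m \<in> M" "k < 4" for m k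
    using Q(4) that G_iff by blast
  let ?sq = "\<lambda>m k. plane_frame (fst (c m k)) (fst (v m)) ` square 7"
  have in_sq: "fst q \<in> ?sq m k \<longleftrightarrow> q \<in> prism (c m k) (v m) 7" if "m \<in> M" for m k q
    unfolding plane_frame_image_iff[OF v_nz[OF that]] by (simp add: prism_def)
  have "\<not> lune Q R" if R: "R \<in> regions Q" for R
  proof (cases "\<exists>m\<in>M. \<exists>k<4. R \<inter> ?sq m k \<noteq> {}")
    case True
    then obtain m k where mk: "m \<in> M" "k < 4" "R \<inter> ?sq m k \<noteq> {}" by blast
    show ?thesis
      by (rule four_kinks_no_lune[of Q "p m" "v m", OF _ mk(2) R])
        (use QK mk in \<open>simp_all add: c_def\<close>)
  next
    case False
    then have off: "R \<inter> ?sq m k = {}" if "m \<in> M" "k < 4" for m k using that by blast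
    have opR: "open R" using open_region[OF Q(1) R] .
    have neR: "R \<noteq> {}" using R in_components_nonempty unfolding regions_def by blast
    have open_sq: "open (?sq m k)" if "m \<in> M" for m k
      by (rule open_plane_frame[OF v_nz[OF that]]) (rule open_square)
    have fr_off: "frontier R \<inter> ?sq m k = {}" if "m \<in> M" "k < 4" for m k
    proof -
      have "?sq m k \<inter> closure R = {}"
        using open_Int_closure_eq_empty[OF open_sq[OF that(1)], of k R] off[OF that] by (simp add: Int_commute)
      then show ?thesis unfolding frontier_def by blast
    qed
    have fr_Q: "frontier R \<subseteq> fst ` Q" using frontier_region[OF Q(1) R] .
    have 37: "prism b w 3 \<subseteq> prism b w 7" for b w by (auto simp: prism_def square_def)
    have fr_P: "x \<in> fst ` P" if x: "x \<in> frontier R" for x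
    proof -
      obtain q where q: "q \<in> Q" "fst q = x" using fr_Q x by blast
      have "q \<notin> prism (c m k) (v m) 3" if "m \<in> M" "k < 4" for m k
        using fr_off[OF that] x q(2) in_sq[OF that(1), of q k] 37 by blast
      then have "q \<notin> (\<Union>(c, u)\<in>G. prism c u 3)" using UN_G by metis
      then show ?thesis using Q(3) q by blast
    qed
    obtain m0 where m0: "m0 \<in> M" using \<open>M \<noteq> {}\<close> by blast
    have "\<not> frontier R \<subseteq> V"
    proof
      assume "frontier R \<subseteq> V"
      then have fin: "finite (frontier R)" using finV finite_subset by metis
      have "?sq m0 0 \<subseteq> frontier R"
        using finite_frontier_plane[OF opR neR fin] off[OF m0, of 0] by auto
      then have "finite (?sq m0 0)" using fin finite_subset by metis
      moreover have "(0, 0) \<in> square 7" by (simp add: square_def)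
      then have "?sq m0 0 \<noteq> {}" by blast
      ultimately show False using finite_imp_not_open open_sq[OF m0, of 0] by metis
    qed
    then obtain x where x: "x \<in> frontier R" "x \<in> fst ` P - V" using fr_P by blast
    then obtain m E where E: "m \<in> M" "connected E" "E \<subseteq> fst ` P - V" "x \<in> E" "m \<in> E"
      using M(3) by blast
    \<comment> \<open>A closed set that contains the modified part of the picture; the large squares keep the frontier away from it.\<close>
    define C where "C = (\<Union>m\<in>M. \<Union>k<4. plane_frame (fst (c m k)) (fst (v m)) ` {w. \<bar>fst w\<bar> \<le> 3 \<and> \<bar>snd w\<bar> \<le> 3})"
    have "closed C" unfolding C_def
    proof (intro closed_UN M(1) ballI finite_lessThan closed_plane_frame v_nz)
      show "closed {w::real \<times> real. \<bar>fst w\<bar> \<le> 3 \<and> \<bar>snd w\<bar> \<le> 3}"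
        by (intro closed_Collect_conj closed_Collect_le continuous_intros)
    qed
    have "{w::real \<times> real. \<bar>fst w\<bar> \<le> 3 \<and> \<bar>snd w\<bar> \<le> 3} \<subseteq> square 7" by (auto simp: square_def)
    then have fr_C: "frontier R \<inter> C = {}" unfolding C_def using fr_off by blast
    have P3_C: "fst q \<in> C" if qG: "q \<in> (\<Union>(c, u)\<in>G. prism c u 3)" for q
    proof -
      obtain m k where mk: "m \<in> M" "k < 4" "q \<in> prism (c m k) (v m) 3" using UN_G[OF qG] by blast
      then have "fst q \<in> plane_frame (fst (c m k)) (fst (v m)) ` {w. \<bar>fst w\<bar> \<le> 3 \<and> \<bar>snd w\<bar> \<le> 3}"
        unfolding plane_frame_image_iff[OF v_nz[OF mk(1)]] by (simp add: prism_def square_def)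
      then show ?thesis unfolding C_def using mk(1,2) by blast
    qed
    have "E \<subseteq> frontier R"
    proof (rule connected_subset_locally[OF E(2) frontier_closed E(4) x(1)])
      fix y assume y: "y \<in> E" "y \<in> frontier R"
      then have "y \<notin> C" using fr_C by blast
      then obtain e where e: "0 < e" "ball y e \<inter> C = {}"
        using \<open>closed C\<close> by (metis ComplI disjoint_eq_subset_Compl open_Compl openE)
      obtain p' u' where p': "fst p' = y" "carries P strand p' u'" "prism p' u' 7 \<subseteq> {q. fst q \<in> ball y e}"
        using straight y(1) E(3) e(1) by (metis subsetD)
      have nz: "fst u' \<noteq> 0" using p'(2) by (simp add: carries_def)
      let ?U = "plane_frame (fst p') (fst u') ` square 7"
      have U_iff: "fst q \<in> ?U \<longleftrightarrow> q \<in> prism p' u' 7" for q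
        unfolding plane_frame_image_iff[OF nz] by (simp add: prism_def)
      have "q \<notin> (\<Union>(c, u)\<in>G. prism c u 3)" if "q \<in> prism p' u' 7" for q
        using P3_C[of q] p'(3) e(2) that by blast
      then have same: "P \<inter> prism p' u' 7 = Q \<inter> prism p' u' 7" using Q(3) by blast
      have "plane_frame (fst p') (fst u') (0, 0) \<in> ?U" by (rule imageI) (simp add: square_def)
      then have yU: "y \<in> ?U" by (simp add: plane_frame_def p'(1))
      have opU: "open ?U" by (intro open_plane_frame nz open_square)
      have "R \<inter> ?U \<noteq> {}"
        using y(2) yU opU unfolding frontier_def by (metis DiffD1 IntI Int_commute empty_iff open_Int_closure_eq_empty)
      then have fr: "fst ` Q \<inter> ?U \<subseteq> frontier R"
        by (rule strand_in_frontier[OF carries_cong[OF p'(2) same] R])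
      have "?U \<inter> E \<subseteq> frontier R"
      proof
        fix z assume z: "z \<in> ?U \<inter> E"
        then obtain r where r: "r \<in> P" "z = fst r" using E(3) by blast
        then have "r \<in> Q" using z U_iff[of r] same by blast
        then show "z \<in> frontier R" using fr z r(2) by blast
      qed
      then show "\<exists>U. open U \<and> y \<in> U \<and> U \<inter> E \<subseteq> frontier R" using opU yU by metis
    qed
    then have "m \<in> frontier R" using E(5) by blast
    moreover have "plane_frame (fst (c m 0)) (fst (v m)) (0, 0) \<in> ?sq m 0" by (rule imageI) (simp add: square_def)
    then have "m \<in> ?sq m 0" using pu(1)[OF E(1)] by (simp add: c_def plane_frame_def)
    ultimately have False using fr_off[OF E(1), of 0] by auto
    then show ?thesis ..
  qed
  then show ?thesis using Q(1,2) unfolding lune_free_def lune_def by blast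
qed

theorem corollary2p1:
  fixes L :: "space set" and d :: int
  assumes "link L"
    and "has_determinant L d"
    and "d \<noteq> 0"
  shows "\<exists>P. represents P L \<and> lune_free P"
proof -
  obtain P where P: "link_diagram P" "ambient_isotopic L P"
    using assms(2) unfolding has_determinant_def represents_def by blast
  obtain Q where "link_diagram Q" "ambient_isotopic P Q" "lune_free Q"
    using link_diagram_lune_free[OF P(1)] by blast
  then show ?thesis
    using ambient_isotopic_trans[OF P(2)] unfolding represents_def by blast
qed

end
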